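(* For the indivisible coflow scheduling problem with precedence constraints in an identical parallel network with $m$ cores (and arbitrary release times), the algorithm coflow-driven-list-scheduling has an approximation ratio of at most $(4m+1)\mu$ for minimizing the total weighted coflow completion time $\sum_{k\in\mathcal{K}} w_k C_k$, where $\mu$ is the maximum number of coflows on a directed path of the precedence graph.
   Context: Identical parallel network: there are $m\ge 1$ identical network cores, each an $N\times N$ non-blocking switch. Source servers form the set $\mathcal{I}=\{1,\dots,N\}$ and destination servers the set $\mathcal{J}=\{1,\dots,N\}$; in every core, input port $i$ is connected to source server $i$ and output port $j$ to destination server $j$, and all links have unit capacity. An instance is a finite set $\mathcal{K}$ of coflows; coflow $k$ has a demand matrix $D^{(k)}=(d_{ijk})_{i,j=1}^N$ of nonnegative integers, a release time $r_k\ge 0$ and a nonnegative weight $w_k$. A flow is a triple $(i,j,k)$ with $d_{ijk}>0$: $d_{ijk}$ units of data to be sent from input $i$ to output $j$. In a feasible schedule, at every time, in each core each input port sends at total rate at most $1$ and each output port receives at total rate at most $1$, and no data of coflow $k$ is sent before $r_k$. In the indivisible problem, all flows of a coflow must be transmitted through the same core. Precedence constraints are given by a directed acyclic graph $G=(\mathcal{K},E)$: if $(k',k)\in E$ (written $k'\prec k$), no flow of $k$ may be transmitted before all flows of $k'$ have completed. A flow/coflow is ready when all flows of all predecessor coflows have completed. The completion time $C_k$ of coflow $k$ is the completion time of its last flow. $\mu$ is the maximum number of coflows on a directed path in $G$. An algorithm has approximation ratio at most $\alpha$ if on every instance its schedule has objective value at most $\alpha$ times the optimum. Let $L_{ik}=\sum_{j=1}^N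 d_{ijk}$ and $L_{jk}=\sum_{i=1}^N d_{ijk}$. Linear program (LP-I), variables $C_k$: minimize $\sum_k w_kC_k$ subject to $C_k\ge r_k+L_{ik}$ and $C_k\ge r_k+L_{jk}$ for all $k,i,j$; $C_k\ge C_{k'}+L_{ik}$ and $C_k\ge C_{k'}+L_{jk}$ for all $i,j$ and $k'\prec k$; for every input $i$ and every $S\subseteq\mathcal{K}$: $\sum_{k\in S}L_{ik}C_k\ge\frac{1}{2m}\big(\sum_{k\in S}L_{ik}^2+(\sum_{k\in S}L_{ik})^2\big)$; and the same for every output $j$ with $L_{jk}$ in place of $L_{ik}$. Algorithm coflow-driven-list-scheduling: compute an optimal solution $\bar C$ of LP-I. Initialize $load_I(i,h)=load_O(j,h)=0$ and $\mathcal{A}_h=\emptyset$ for all ports and cores $h\in\{1,\dots,m\}$. For every coflow $k$ in non-decreasing order of $\bar C_k$ (ties arbitrary): choose $h^*\in\arg\min_h \max_{i,j}\big(load_I(i,h)+load_O(j,h)+L_{ik}+L_{jk}\big)$, add $k$ to $\mathcal{A}_{h^*}$, and for all $i,j$ increase $load_I(i,h^* )$ by $L_{ik}$ and $load_O(j,h^* )$ by $L_{jk}$. Then in each core $h$ in parallel: wait until the first coflow is released; while some flow is incomplete, list the ready, released and incomplete flows of the coflows in $\mathcal{A}_h$ in non-decreasing order of $\bar C_k$ of their coflows, go through this list and schedule each flow $f=(i,j,k)$ if the link $(i,j)$ is idle (neither input port $i$ nor output port $j$ of core $h$ is used by an already scheduled flow); transmit the scheduled flows at rate $1$ until some new flow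 becomes ready, completes or is released, and repeat. *)

theory Defs
  imports "HOL-Analysis.Analysis"
begin

text \<open>Ports (servers) are the numbers 1 to \<open>ports\<close>, cores the numbers 1 to \<open>cores\<close>;
  \<open>(k', k) \<in> prec\<close> means that \<open>k'\<close> precedes \<open>k\<close>.  Time is continuous.\<close>

record 'k coflow_instance =
  ports :: nat
  cores :: nat
  coflows :: "'k set"
  demand :: "nat \<Rightarrow> nat \<Rightarrow> 'k \<Rightarrow> nat"
  release :: "'k \<Rightarrow> real"
  weight :: "'k \<Rightarrow> real"
  prec :: "('k \<times> 'k) set"

definition valid_instance :: "'k coflow_instance \<Rightarrow> bool" where
  "valid_instance I \<longleftrightarrow>
     ports I \<ge> 1 \<and> cores I \<ge> 1 \<and> finite (coflows I) \<and>
     (\<forall>k\<in>coflows I. release I k \<ge> 0 \<and> weight I k \<ge> 0) \<and>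
     prec I \<subseteq> coflows I \<times> coflows I \<and> acyclic (prec I)"

abbreviation port_set :: "'k coflow_instance \<Rightarrow> nat set" where
  "port_set I \<equiv> {1..ports I}"

abbreviation core_set :: "'k coflow_instance \<Rightarrow> nat set" where
  "core_set I \<equiv> {1..cores I}"

type_synonym 'k flow = "nat \<times> nat \<times> 'k"

abbreviation input_of :: "'k flow \<Rightarrow> nat" where "input_of f \<equiv> fst f"
abbreviation output_of :: "'k flow \<Rightarrow> nat" where "output_of f \<equiv> fst (snd f)"
abbreviation coflow_of :: "'k flow \<Rightarrow> 'k" where "coflow_of f \<equiv> snd (snd f)"

definition flow_demand :: "'k coflow_instance \<Rightarrow> 'k flow \<Rightarrow> real" where
  "flow_demand I f = real (demand I (input_of f) (output_of f) (coflow_of f))"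

definition flows :: "'k coflow_instance \<Rightarrow> 'k flow set" where
  "flows I = {(i, j, k). i \<in> port_set I \<and> j \<in> port_set I \<and> k \<in> coflows I \<and> demand I i j k > 0}"

definition flows_of :: "'k coflow_instance \<Rightarrow> 'k \<Rightarrow> 'k flow set" where
  "flows_of I k = {f \<in> flows I. coflow_of f = k}"

definition in_load :: "'k coflow_instance \<Rightarrow> nat \<Rightarrow> 'k \<Rightarrow> real" where
  "in_load I i k = (\<Sum>j\<in>port_set I. real (demand I i j k))"

definition out_load :: "'k coflow_instance \<Rightarrow> nat \<Rightarrow> 'k \<Rightarrow> real" where
  "out_load I j k = (\<Sum>i\<in>port_set I. real (demand I i j k))"

text \<open>The maximum number of coflows on a directed path.  The empty list is admitted only to give the
  value 0 to an instance without coflows.\<close>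

definition max_path_coflows :: "'k coflow_instance \<Rightarrow> nat" where
  "max_path_coflows I =
     Max {length p | p. distinct p \<and> set p \<subseteq> coflows I \<and> successively (\<lambda>a b. (a, b) \<in> prec I) p}"

text \<open>\<open>x h f t\<close> is the rate at which core \<open>h\<close> transmits flow \<open>f\<close> at time \<open>t\<close>.\<close>

type_synonym 'k schedule = "nat \<Rightarrow> 'k flow \<Rightarrow> real \<Rightarrow> real"

definition sent :: "'k coflow_instance \<Rightarrow> 'k schedule \<Rightarrow> 'k flow \<Rightarrow> real \<Rightarrow> real" where
  "sent I x f T = (\<Sum>h\<in>core_set I. integral {0..T} (x h f))"

definition flow_completion :: "'k coflow_instance \<Rightarrow> 'k schedule \<Rightarrow> 'k flow \<Rightarrow> real" where
  "flow_completion I x f = Inf {T. T \<ge> 0 \<and> sent I x f T = flow_demand I f}"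

text \<open>A coflow whose demand matrix is zero has no last flow.  By convention it completes as soon as it
  is released and all its predecessors have completed; written without recursion, this is the
  maximum of the release times and flow completion times of all its ancestors, itself included.\<close>

definition coflow_completion :: "'k coflow_instance \<Rightarrow> 'k schedule \<Rightarrow> 'k \<Rightarrow> real" where
  "coflow_completion I x k =
     (if flows_of I k \<noteq> {} then Max (flow_completion I x ` flows_of I k)
      else Max (\<Union>k'\<in>{k'. (k', k) \<in> (prec I)\<^sup>*}.
                  insert (release I k') (flow_completion I x ` flows_of I k')))"

definition feasible :: "'k coflow_instance \<Rightarrow> 'k schedule \<Rightarrow> bool" where
  "feasible I x \<longleftrightarrow>
     (\<forall>h\<in>core_set I. \<forall>f\<in>flows I. \<forall>T\<ge>0. x h f integrable_on {0..T}) \<and>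
     (\<forall>h\<in>core_set I. \<forall>f\<in>flows I. \<forall>t\<ge>0. x h f t \<ge> 0) \<and>
     (\<forall>h\<in>core_set I. \<forall>i\<in>port_set I. \<forall>t\<ge>0. (\<Sum>f | f \<in> flows I \<and> input_of f = i. x h f t) \<le> 1) \<and>
     (\<forall>h\<in>core_set I. \<forall>j\<in>port_set I. \<forall>t\<ge>0. (\<Sum>f | f \<in> flows I \<and> output_of f = j. x h f t) \<le> 1) \<and>
     (\<forall>f\<in>flows I. (\<forall>T\<ge>0. sent I x f T \<le> flow_demand I f) \<and>
                  (\<exists>T\<ge>0. sent I x f T = flow_demand I f)) \<and>
     (\<forall>h\<in>core_set I. \<forall>f\<in>flows I. \<forall>t\<ge>0. t < release I (coflow_of f) \<longrightarrow> x h f t = 0) \<and>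
     (\<forall>(k', k)\<in>prec I. \<forall>h\<in>core_set I. \<forall>f\<in>flows_of I k. \<forall>t\<ge>0.
        t < coflow_completion I x k' \<longrightarrow> x h f t = 0)"

definition indivisible :: "'k coflow_instance \<Rightarrow> 'k schedule \<Rightarrow> bool" where
  "indivisible I x \<longleftrightarrow>
     (\<forall>k\<in>coflows I. \<exists>h\<in>core_set I. \<forall>h'\<in>core_set I. h' \<noteq> h \<longrightarrow>
        (\<forall>f\<in>flows_of I k. \<forall>t\<ge>0. x h' f t = 0))"

definition total_weighted_completion :: "'k coflow_instance \<Rightarrow> 'k schedule \<Rightarrow> real" where
  "total_weighted_completion I x = (\<Sum>k\<in>coflows I. weight I k * coflow_completion I x k)"

definition optimum :: "'k coflow_instance \<Rightarrow> real" where
  "optimum I = Inf (total_weighted_completion I ` {x. feasible I x \<and> indivisible I x})"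

definition lp_feasible :: "'k coflow_instance \<Rightarrow> ('k \<Rightarrow> real) \<Rightarrow> bool" where
  "lp_feasible I C \<longleftrightarrow>
     (\<forall>k\<in>coflows I. \<forall>i\<in>port_set I. C k \<ge> release I k + in_load I i k) \<and>
     (\<forall>k\<in>coflows I. \<forall>j\<in>port_set I. C k \<ge> release I k + out_load I j k) \<and>
     (\<forall>(k', k)\<in>prec I. \<forall>i\<in>port_set I. C k \<ge> C k' + in_load I i k) \<and>
     (\<forall>(k', k)\<in>prec I. \<forall>j\<in>port_set I. C k \<ge> C k' + out_load I j k) \<and>
     (\<forall>i\<in>port_set I. \<forall>S\<subseteq>coflows I.
        (\<Sum>k\<in>S. in_load I i k * C k) \<ge>
          1 / (2 * real (cores I)) * ((\<Sum>k\<in>S. (in_load I i k)\<^sup>2) + (\<Sum>k\<in>S. in_load I i k)\<^sup>2)) \<and>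
     (\<forall>j\<in>port_set I. \<forall>S\<subseteq>coflows I.
        (\<Sum>k\<in>S. out_load I j k * C k) \<ge>
          1 / (2 * real (cores I)) * ((\<Sum>k\<in>S. (out_load I j k)\<^sup>2) + (\<Sum>k\<in>S. out_load I j k)\<^sup>2))"

definition lp_optimal :: "'k coflow_instance \<Rightarrow> ('k \<Rightarrow> real) \<Rightarrow> bool" where
  "lp_optimal I C \<longleftrightarrow> lp_feasible I C \<and>
     (\<forall>C'. lp_feasible I C' \<longrightarrow>
        (\<Sum>k\<in>coflows I. weight I k * C k) \<le> (\<Sum>k\<in>coflows I. weight I k * C' k))"

text \<open>\<open>assignment_run I ks lI lO A\<close>: after the coflows of \<open>ks\<close> have been processed in this order,
  \<open>lI\<close> and \<open>lO\<close> may be the port loads and \<open>A h\<close> the coflows placed on core \<open>h\<close>.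
  The relation is not functional because the minimising core need not be unique.\<close>

inductive assignment_run ::
  "'k coflow_instance \<Rightarrow> 'k list \<Rightarrow> (nat \<Rightarrow> nat \<Rightarrow> real) \<Rightarrow> (nat \<Rightarrow> nat \<Rightarrow> real) \<Rightarrow> (nat \<Rightarrow> 'k set) \<Rightarrow> bool"
  for I :: "'k coflow_instance"
where
  init: "assignment_run I [] (\<lambda>i h. 0) (\<lambda>j h. 0) (\<lambda>h. {})"
| assign: "assignment_run I ks lI lO A \<Longrightarrow>
     is_arg_min
       (\<lambda>h. Max {lI i h + lO j h + in_load I i k + out_load I j k | i j. i \<in> port_set I \<and> j \<in> port_set I})
       (\<lambda>h. h \<in> core_set I) h' \<Longrightarrow>
     assignment_run I (ks @ [k])
       (\<lambda>i h. if h = h' then lI i h + in_load I i k else lI i h)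
       (\<lambda>j h. if h = h' then lO j h + out_load I j k else lO j h)
       (A(h' := insert k (A h')))"

text \<open>A state of the transmission phase consists of the current time \<open>t\<close> and the remaining demand
  \<open>rem\<close> of every flow.  Coflows without flows are treated as in \<^const>\<open>coflow_completion\<close>.\<close>

definition coflow_done :: "'k coflow_instance \<Rightarrow> real \<Rightarrow> ('k flow \<Rightarrow> real) \<Rightarrow> 'k \<Rightarrow> bool" where
  "coflow_done I t rem k \<longleftrightarrow>
     (if flows_of I k \<noteq> {} then \<forall>f\<in>flows_of I k. rem f = 0
      else \<forall>k'. (k', k) \<in> (prec I)\<^sup>* \<longrightarrow> release I k' \<le> t \<and> (\<forall>f\<in>flows_of I k'. rem f = 0))"

definition coflow_ready :: "'k coflow_instance \<Rightarrow> real \<Rightarrow> ('k flow \<Rightarrow> real) \<Rightarrow> 'k \<Rightarrow> bool" where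
  "coflow_ready I t rem k \<longleftrightarrow> (\<forall>k'. (k', k) \<in> prec I \<longrightarrow> coflow_done I t rem k')"

definition available ::
  "'k coflow_instance \<Rightarrow> 'k set \<Rightarrow> real \<Rightarrow> ('k flow \<Rightarrow> real) \<Rightarrow> 'k flow set" where
  "available I B t rem =
     {f \<in> flows I. coflow_of f \<in> B \<and> coflow_ready I t rem (coflow_of f) \<and>
                   release I (coflow_of f) \<le> t \<and> rem f > 0}"

fun greedy :: "'k flow list \<Rightarrow> 'k flow set \<Rightarrow> 'k flow set" where
  "greedy [] F = F"
| "greedy (f # fs) F =
     (if \<forall>g\<in>F. input_of g \<noteq> input_of f \<and> output_of g \<noteq> output_of f
      then greedy fs (insert f F) else greedy fs F)"

text \<open>\<open>F h\<close> is a set of flows that core \<open>h\<close> may schedule; flows with equal LP value may be listed in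
  any order.\<close>

definition scheduled ::
  "'k coflow_instance \<Rightarrow> ('k \<Rightarrow> real) \<Rightarrow> (nat \<Rightarrow> 'k set) \<Rightarrow> real \<Rightarrow> ('k flow \<Rightarrow> real) \<Rightarrow>
   (nat \<Rightarrow> 'k flow set) \<Rightarrow> bool" where
  "scheduled I C A t rem F \<longleftrightarrow>
     (\<forall>h\<in>core_set I. \<exists>fs. distinct fs \<and> set fs = available I (A h) t rem \<and>
        sorted_wrt (\<lambda>f g. C (coflow_of f) \<le> C (coflow_of g)) fs \<and> F h = greedy fs {})"

text \<open>The time until the next event, which is a completion or a release: a flow becomes ready only
  when one of these happens.\<close>

definition time_to_event ::
  "'k coflow_instance \<Rightarrow> real \<Rightarrow> ('k flow \<Rightarrow> real) \<Rightarrow> (nat \<Rightarrow> 'k flow set) \<Rightarrow> real" where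
  "time_to_event I t rem F =
     Min (rem ` (\<Union>h\<in>core_set I. F h) \<union> {release I k - t | k. k \<in> coflows I \<and> release I k > t})"

text \<open>All cores proceed in parallel; \<open>tm n\<close> is the time of the \<open>n\<close>-th event, \<open>rem n\<close> the demand
  remaining then, and \<open>F n h\<close> the set of flows which core \<open>h\<close> transmits until the next event.
  An event on one core makes every core rebuild its list; a core whose available flows have not
  changed may choose the same list again and thus simply continue.
  A core with no available flow (for instance because none of its coflows has been released yet)
  transmits nothing and waits for the next event.  Once every flow is complete the
  state remains constant.  That this happens after finitely many events is not presupposed.\<close>

definition transmission_run ::
  "'k coflow_instance \<Rightarrow> ('k \<Rightarrow> real) \<Rightarrow> (nat \<Rightarrow> 'k set) \<Rightarrow>
   (nat \<Rightarrow> real) \<Rightarrow> (nat \<Rightarrow> 'k flow \<Rightarrow> real) \<Rightarrow> (nat \<Rightarrow> nat \<Rightarrow> 'k flow set) \<Rightarrow> bool" where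
  "transmission_run I C A tm rem F \<longleftrightarrow>
     tm 0 = 0 \<and> rem 0 = flow_demand I \<and>
     (\<forall>n. if \<forall>f\<in>flows I. rem n f = 0
          then tm (Suc n) = tm n \<and> rem (Suc n) = rem n
          else scheduled I C A (tm n) (rem n) (F n) \<and>
               tm (Suc n) = tm n + time_to_event I (tm n) (rem n) (F n) \<and>
               rem (Suc n) = (\<lambda>f. if f \<in> (\<Union>h\<in>core_set I. F n h)
                                  then rem n f - time_to_event I (tm n) (rem n) (F n)
                                  else rem n f))"

definition run_schedule :: "(nat \<Rightarrow> real) \<Rightarrow> (nat \<Rightarrow> nat \<Rightarrow> 'k flow set) \<Rightarrow> 'k schedule" where
  "run_schedule tm F = (\<lambda>h f t. if \<exists>n. tm n \<le> t \<and> t < tm (Suc n) \<and> f \<in> F n h then 1 else 0)"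

text \<open>\<open>x\<close> is a schedule which the algorithm may produce, for some choice of the LP optimum and some
  way of breaking ties.\<close>

definition coflow_driven_list_scheduling :: "'k coflow_instance \<Rightarrow> 'k schedule \<Rightarrow> bool" where
  "coflow_driven_list_scheduling I x \<longleftrightarrow>
     (\<exists>C ks lI lO A tm rem F.
        lp_optimal I C \<and>
        distinct ks \<and> set ks = coflows I \<and> sorted_wrt (\<lambda>k k'. C k \<le> C k') ks \<and>
        assignment_run I ks lI lO A \<and>
        transmission_run I C A tm rem F \<and>
        x = run_schedule tm F)"

end

theory Submission imports Defs begin

text \<open>The LP values \<open>C\<close> satisfy two estimates.  First, they bound the optimum from below, because the
  coflow completion times of any feasible indivisible schedule satisfy the LP constraints: on one
  core, the coflows completed by time \<open>T\<close> put a load of at most \<open>T\<close> on each port, which gives the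
  single machine volume inequality, and Cauchy--Schwarz combines the cores.  Second, the volume
  inequality for the set of all \<open>l\<close> with \<open>C l \<le> C k\<close> shows that these coflows load each port by at
  most \<open>2 m C k\<close>.  Once coflow \<open>k\<close> is released and ready, each of its flows is delayed only by flows
  of such coflows at its two ports and hence completes within time \<open>4 m C k\<close>, whatever the
  assignment to cores.  Since \<open>C\<close> dominates the release times and increases along the precedence
  relation, induction on the depth \<open>d\<close> of \<open>k\<close> bounds its completion time by \<open>(4 m + 1) d C k\<close>.\<close>

section \<open>Port loads and the linear program\<close>

text \<open>The two ports of a flow contribute \<open>2 m C k\<close> of delay each, which is the
  \<open>4 m\<close>. The remaining \<open>1\<close> pays for waiting until time \<open>C k\<close>,
  by which \<open>k\<close> and all its ancestors are released. At depth \<open>d\<close> the start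
  of service is bounded by the maximum of \<open>C k\<close> and
  \<open>(4 m + 1) (d - 1) C k\<close>, and adding \<open>4 m C k\<close> to either term stays below
  \<open>(4 m + 1) d C k\<close>. The obstacle is a coflow without flows: no transmission witnesses
  its completion, so its completion time and its being done refer to all its ancestors. Waiting
  arguments therefore quantify over the transitive closure of the precedence relation instead of
  direct predecessors. The claim also asserts that a run exists and that what it produces is a
  feasible indivisible schedule. This requires an LP optimum, termination after finitely many
  events, and a translation between the discrete states of a run, where delays are estimated, and
  the integrals that define sent data.\<close>

definition sides :: "('k flow \<Rightarrow> nat) set" where
  "sides = {\<lambda>f. input_of f, \<lambda>f. output_of f}"

definition port_loads :: "'k coflow_instance \<Rightarrow> ('k \<Rightarrow> real) set" where
  "port_loads I = in_load I ` port_set I \<union> out_load I ` port_set I"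

text \<open>Ports enter the LP only through their load functions, and input and output ports impose
  constraints of the same shape. Isolating one load lets each LP argument treat a single port at a
  time.\<close>

definition load_constraints :: "'k coflow_instance \<Rightarrow> ('k \<Rightarrow> real) \<Rightarrow> ('k \<Rightarrow> real) \<Rightarrow> bool" where
  "load_constraints I L C \<longleftrightarrow>
     (\<forall>k\<in>coflows I. release I k + L k \<le> C k) \<and>
     (\<forall>(k', k)\<in>prec I. C k' + L k \<le> C k) \<and>
     (\<forall>S\<subseteq>coflows I.
        1 / (2 * real (cores I)) * ((\<Sum>k\<in>S. (L k)\<^sup>2) + (\<Sum>k\<in>S. L k)\<^sup>2) \<le> (\<Sum>k\<in>S. L k * C k))"

lemma lp_feasible_iff: "lp_feasible I C \<longleftrightarrow> (\<forall>L\<in>port_loads I. load_constraints I L C)"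
proof -
  have "(\<forall>L\<in>in_load I ` port_set I. load_constraints I L C) \<and> (\<forall>L\<in>out_load I ` port_set I. load_constraints I L C)
    \<longleftrightarrow> lp_feasible I C"
    unfolding lp_feasible_def load_constraints_def case_prod_unfold ball_simps ball_conj_distrib
    by (intro iffI conjI; elim conjE; intro ballI allI impI; simp only: Ball_def)
  then show ?thesis by (simp add: port_loads_def ball_Un)
qed

lemma finite_port_loads: "finite (port_loads I)"
  by (simp add: port_loads_def)

lemma port_loads_nonneg: "L \<in> port_loads I \<Longrightarrow> 0 \<le> L k"
  by (auto simp: port_loads_def in_load_def out_load_def intro!: sum_nonneg)

lemma finite_flows: "valid_instance I \<Longrightarrow> finite (flows I)"
  by (rule finite_subset[of _ "port_set I \<times> port_set I \<times> coflows I"])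
     (auto simp: flows_def valid_instance_def)

lemma flows_of_subset: "flows_of I k \<subseteq> flows I"
  by (auto simp: flows_of_def)

lemma finite_flows_of: "valid_instance I \<Longrightarrow> finite (flows_of I k)"
  by (rule finite_subset[OF flows_of_subset finite_flows])

lemma coflow_of_flows: "f \<in> flows I \<Longrightarrow> coflow_of f \<in> coflows I"
  by (auto simp: flows_def)

lemma flow_demand_pos: "f \<in> flows I \<Longrightarrow> 0 < flow_demand I f"
  by (auto simp: flows_def flow_demand_def)

lemma flows_port: "f \<in> flows I \<Longrightarrow> input_of f \<in> port_set I \<and> output_of f \<in> port_set I"
  by (auto simp: flows_def)

lemma in_load_eq:
  assumes "i \<in> port_set I" "k \<in> coflows I"
  shows "in_load I i k = (\<Sum>f | f \<in> flows_of I k \<and> input_of f = i. flow_demand I f)"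
proof -
  let ?J = "{j \<in> port_set I. demand I i j k > 0}"
  have eq: "{f. f \<in> flows_of I k \<and> input_of f = i} = (\<lambda>j. (i, j, k)) ` ?J"
    using assms by (auto simp: flows_of_def flows_def)
  have "in_load I i k = (\<Sum>j\<in>?J. real (demand I i j k))"
    unfolding in_load_def by (rule sum.mono_neutral_right) auto
  also have "\<dots> = (\<Sum>f\<in>(\<lambda>j. (i, j, k)) ` ?J. flow_demand I f)"
    by (subst sum.reindex) (auto simp: inj_on_def flow_demand_def)
  finally show ?thesis by (simp only: eq)
qed

lemma out_load_eq:
  assumes "j \<in> port_set I" "k \<in> coflows I"
  shows "out_load I j k = (\<Sum>f | f \<in> flows_of I k \<and> output_of f = j. flow_demand I f)"
proof -
  let ?J = "{i \<in> port_set I. demand I i j k > 0}"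
  have eq: "{f. f \<in> flows_of I k \<and> output_of f = j} = (\<lambda>i. (i, j, k)) ` ?J"
    using assms by (auto simp: flows_of_def flows_def)
  have "out_load I j k = (\<Sum>i\<in>?J. real (demand I i j k))"
    unfolding out_load_def by (rule sum.mono_neutral_right) auto
  also have "\<dots> = (\<Sum>f\<in>(\<lambda>i. (i, j, k)) ` ?J. flow_demand I f)"
    by (subst sum.reindex) (auto simp: inj_on_def flow_demand_def)
  finally show ?thesis by (simp only: eq)
qed

lemma port_loadsE:
  assumes "L \<in> port_loads I"
  obtains p i where "p \<in> sides" "i \<in> port_set I"
    "\<forall>k\<in>coflows I. L k = (\<Sum>f | f \<in> flows_of I k \<and> p f = i. flow_demand I f)"
proof -
  consider i where "i \<in> port_set I" "L = in_load I i" | j where "j \<in> port_set I" "L = out_load I j"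
    using assms by (auto simp: port_loads_def)
  then show ?thesis
  proof cases
    case (1 i)
    show ?thesis by (rule that[of "\<lambda>f. input_of f" i]) (use 1 in \<open>simp_all add: sides_def in_load_eq\<close>)
  next
    case (2 j)
    show ?thesis by (rule that[of "\<lambda>f. output_of f" j]) (use 2 in \<open>simp_all add: sides_def out_load_eq\<close>)
  qed
qed

lemma sum_flows_by_coflow:
  assumes "valid_instance I" "S \<subseteq> coflows I"
  shows "(\<Sum>k\<in>S. \<Sum>f | f \<in> flows_of I k \<and> P f. g f)
       = (\<Sum>f | f \<in> flows I \<and> coflow_of f \<in> S \<and> P f. g f)"
proof -
  have "finite S" using assms by (auto simp: valid_instance_def intro: finite_subset)
  then have "(\<Sum>k\<in>S. \<Sum>f | f \<in> flows_of I k \<and> P f. g f)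
    = (\<Sum>f \<in> (\<Union>k\<in>S. {f. f \<in> flows_of I k \<and> P f}). g f)"
    by (subst sum.UNION_disjoint)
       (auto simp: flows_of_def intro!: finite_subset[OF _ finite_flows[OF assms(1)]])
  also have "(\<Union>k\<in>S. {f. f \<in> flows_of I k \<and> P f}) = {f. f \<in> flows I \<and> coflow_of f \<in> S \<and> P f}"
    by (auto simp: flows_of_def)
  finally show ?thesis .
qed

section \<open>Consequences of LP feasibility\<close>

lemma lp_feasible_bounds:
  assumes v: "valid_instance I" and C: "lp_feasible I C"
  shows lp_feasible_release_le: "k \<in> coflows I \<Longrightarrow> release I k \<le> C k"
    and lp_feasible_nonneg: "k \<in> coflows I \<Longrightarrow> 0 \<le> C k"
    and lp_feasible_ancestor_le: "(k', k) \<in> (prec I)\<^sup>* \<Longrightarrow> C k' \<le> C k"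
proof -
  have L: "in_load I 1 \<in> port_loads I" (is "?L \<in> _")
    using v by (simp add: valid_instance_def port_loads_def)
  have nn: "0 \<le> ?L k" for k by (rule port_loads_nonneg[OF L])
  have LC: "load_constraints I ?L C" using C L by (simp add: lp_feasible_iff)
  show r: "release I k \<le> C k" if "k \<in> coflows I" for k
    using LC nn[of k] that by (force simp: load_constraints_def)
  show "0 \<le> C k" if "k \<in> coflows I"
    using r[OF that] v that by (force simp: valid_instance_def)
  have step: "C a \<le> C b" if "(a, b) \<in> prec I" for a b
    using LC nn[of b] that by (force simp: load_constraints_def)
  show "C k' \<le> C k" if "(k', k) \<in> (prec I)\<^sup>*"
    using that by induction (auto intro: order_trans step)
qed

text \<open>In the volume inequality for the prefix, every \<open>C l\<close> on the large side is
  at most \<open>C k\<close>, so that side is at most \<open>?s * C k\<close>. On the small side the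
  term \<open>?s\<^sup>2 / (2 m)\<close> alone suffices, and cancelling one factor \<open>?s\<close>
  leaves the claim.\<close>

lemma lp_feasible_prefix_load:
  assumes v: "valid_instance I" and C: "lp_feasible I C" and L: "L \<in> port_loads I"
    and k: "k \<in> coflows I"
  shows "(\<Sum>l | l \<in> coflows I \<and> C l \<le> C k. L l) \<le> 2 * real (cores I) * C k"
proof -
  let ?S = "{l. l \<in> coflows I \<and> C l \<le> C k}"
  let ?s = "\<Sum>l\<in>?S. L l"
  have m: "real (cores I) > 0" using v by (simp add: valid_instance_def)
  have nn: "0 \<le> L l" for l by (rule port_loads_nonneg[OF L])
  have "1 / (2 * real (cores I)) * ((\<Sum>l\<in>?S. (L l)\<^sup>2) + ?s\<^sup>2) \<le> (\<Sum>l\<in>?S. L l * C l)"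
    using C L by (auto simp: lp_feasible_iff load_constraints_def)
  also have "\<dots> \<le> (\<Sum>l\<in>?S. L l * C k)"
    by (rule sum_mono) (auto intro: mult_left_mono nn)
  also have "\<dots> = ?s * C k" by (simp add: sum_distrib_right)
  finally have 1: "1 / (2 * real (cores I)) * ((\<Sum>l\<in>?S. (L l)\<^sup>2) + ?s\<^sup>2) \<le> ?s * C k" .
  have "(1 / (2 * real (cores I))) * ?s\<^sup>2 \<le> 1 / (2 * real (cores I)) * ((\<Sum>l\<in>?S. (L l)\<^sup>2) + ?s\<^sup>2)"
    using m by (intro mult_left_mono) (auto intro: sum_nonneg)
  with 1 have "1 / (2 * real (cores I)) * ?s\<^sup>2 \<le> ?s * C k" by linarith
  then have 2: "?s * ?s \<le> ?s * (2 * real (cores I) * C k)"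
    using m by (simp add: field_simps power2_eq_square)
  show ?thesis
  \<comment> \<open>Cancelling \<open>?s\<close> requires it to be positive; otherwise nonnegativity
    of \<open>C k\<close> is enough.\<close>
  proof (cases "?s > 0")
    case True
    with 2 show ?thesis by (simp only: mult_le_cancel_left_pos)
  next
    case False
    moreover have "0 \<le> 2 * real (cores I) * C k" using lp_feasible_nonneg[OF v C k] by simp
    ultimately show ?thesis by linarith
  qed
qed

text \<open>Adding \<open>S2\<close> raises the bracket by \<open>q + 2 * a * b + b * b\<close>,
  where \<open>q \<le> b * b\<close>. Half of this is at most \<open>a * b + b * b\<close>, hence at
  most \<open>b * (2 * (a + b))\<close>, which the large values on \<open>S2\<close> supply. It
  serves both to cut down a feasible solution and, with \<open>S1\<close> empty, to produce
  one.\<close>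

lemma load_volume_extend:
  fixes L C :: "'a \<Rightarrow> real"
  assumes "finite S1" "finite S2" "S1 \<inter> S2 = {}" and nn: "\<And>k. 0 \<le> L k" and m: "m \<ge> (1::real)"
    and 1: "1 / (2 * m) * ((\<Sum>k\<in>S1. (L k)\<^sup>2) + (\<Sum>k\<in>S1. L k)\<^sup>2) \<le> (\<Sum>k\<in>S1. L k * C k)"
    and 2: "\<And>k. k \<in> S2 \<Longrightarrow> 2 * (\<Sum>k\<in>S1 \<union> S2. L k) \<le> C k"
  shows "1 / (2 * m) * ((\<Sum>k\<in>S1 \<union> S2. (L k)\<^sup>2) + (\<Sum>k\<in>S1 \<union> S2. L k)\<^sup>2) \<le> (\<Sum>k\<in>S1 \<union> S2. L k * C k)"
proof -
  define a b q where "a = sum L S1" and "b = sum L S2" and "q = (\<Sum>k\<in>S2. (L k)\<^sup>2)"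
  have ab: "sum L (S1 \<union> S2) = a + b" using assms by (simp add: sum.union_disjoint a_def b_def)
  have a0: "a \<ge> 0" and b0: "b \<ge> 0" and q0: "q \<ge> 0" by (auto simp: a_def b_def q_def nn intro: sum_nonneg)
  have "q \<le> (\<Sum>k\<in>S2. L k * b)" unfolding q_def power2_eq_square
    by (rule sum_mono) (auto simp: b_def nn assms intro!: mult_left_mono member_le_sum)
  then have qb: "q \<le> b * b" by (simp add: b_def sum_distrib_right)
  have "1 / (2 * m) * (q + 2 * a * b + b * b) \<le> 1 / 2 * (q + 2 * a * b + b * b)"
    using m a0 b0 q0 by (intro mult_right_mono) (auto simp: field_simps)
  also have "\<dots> \<le> b * (2 * (a + b))" using qb mult_nonneg_nonneg[OF a0 b0] mult_nonneg_nonneg[OF b0 b0]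
    unfolding distrib_left by (simp add: mult.commute mult.left_commute; linarith)
  also have "\<dots> = (\<Sum>k\<in>S2. L k * (2 * (a + b)))" by (simp add: b_def sum_distrib_right)
  also have "\<dots> \<le> (\<Sum>k\<in>S2. L k * C k)"
    using 2 by (intro sum_mono mult_left_mono nn) (simp add: ab)
  finally have "1 / (2 * m) * (q + 2 * a * b + b * b) \<le> (\<Sum>k\<in>S2. L k * C k)" .
  with 1 have "1 / (2 * m) * ((\<Sum>k\<in>S1. (L k)\<^sup>2) + a\<^sup>2 + (q + 2 * a * b + b * b)) \<le> (\<Sum>k\<in>S1. L k * C k) + (\<Sum>k\<in>S2. L k * C k)"
    unfolding a_def[symmetric] by (simp add: distrib_left)
  then show ?thesis
    unfolding ab using assms(1-3) by (simp add: sum.union_disjoint q_def power2_eq_square algebra_simps)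
qed

text \<open>The first factor dominates every release time plus load and twice the total load of
  every port, as \<open>load_volume_extend\<close> demands. The second factor counts
  \<open>k\<close> and its proper ancestors, so the cap grows by at least the first factor, and thus
  by at least any load, along each precedence edge.\<close>

definition lp_cap :: "'k coflow_instance \<Rightarrow> 'k \<Rightarrow> real" where
  "lp_cap I k =
     ((\<Sum>L\<in>port_loads I. 2 * (\<Sum>l\<in>coflows I. L l)) + (\<Sum>l\<in>coflows I. release I l)) *
     (1 + real (card {k'. (k', k) \<in> (prec I)\<^sup>+}))"

lemma trancl_prec_subset: "valid_instance I \<Longrightarrow> (prec I)\<^sup>+ \<subseteq> coflows I \<times> coflows I"
  unfolding valid_instance_def by (intro trancl_subset_Sigma) blast

lemma rtrancl_prec_coflow:
  "valid_instance I \<Longrightarrow> (k', k) \<in> (prec I)\<^sup>* \<Longrightarrow> k \<in> coflows I \<Longrightarrow> k' \<in> coflows I"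
  using trancl_prec_subset[of I] by (auto simp: rtrancl_eq_or_trancl)

lemma lp_cap_bounds:
  assumes v: "valid_instance I" and L: "L \<in> port_loads I"
  shows lp_cap_release: "k \<in> coflows I \<Longrightarrow> release I k + L k \<le> lp_cap I k"
    and lp_cap_prec: "(k', k) \<in> prec I \<Longrightarrow> lp_cap I k' + L k \<le> lp_cap I k"
    and lp_cap_volume: "S \<subseteq> coflows I \<Longrightarrow> 2 * (\<Sum>l\<in>S. L l) \<le> lp_cap I k"
    and lp_cap_nonneg: "0 \<le> lp_cap I k"
proof -
  define B where "B = (\<Sum>L\<in>port_loads I. 2 * (\<Sum>l\<in>coflows I. L l)) + (\<Sum>l\<in>coflows I. release I l)"
  define c where "c k = real (card {k'. (k', k) \<in> (prec I)\<^sup>+})" for k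
  have cap: "lp_cap I k = B * (1 + c k)" for k by (simp add: lp_cap_def B_def c_def)
  have fin: "finite (coflows I)" and r0: "l \<in> coflows I \<Longrightarrow> 0 \<le> release I l" for l
    using v by (auto simp: valid_instance_def)
  note nn = port_loads_nonneg
  have Lsum: "2 * (\<Sum>l\<in>coflows I. L l) \<le> (\<Sum>L\<in>port_loads I. 2 * (\<Sum>l\<in>coflows I. L l))"
    by (rule member_le_sum[OF L]) (auto simp: finite_port_loads intro!: sum_nonneg intro: nn)
  have rsum: "0 \<le> (\<Sum>l\<in>coflows I. release I l)" by (auto intro: sum_nonneg r0)
  have L0: "0 \<le> (\<Sum>l\<in>coflows I. L l)" by (auto intro: sum_nonneg nn[OF L])
  have B0: "0 \<le> B" using Lsum rsum L0 by (simp add: B_def)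
  have capB: "B \<le> lp_cap I k" for k
    unfolding cap using mult_left_mono[OF _ B0, of 1 "1 + c k"] by (simp add: c_def)
  have single: "L k \<le> (\<Sum>l\<in>coflows I. L l)" if "k \<in> coflows I" for k
    by (rule member_le_sum) (auto simp: fin that nn[OF L])
  show "0 \<le> lp_cap I k" using B0 capB[of k] by linarith
  show "release I k + L k \<le> lp_cap I k" if k: "k \<in> coflows I"
  proof -
    have "release I k \<le> (\<Sum>l\<in>coflows I. release I l)"
      by (rule member_le_sum) (auto simp: fin k r0)
    then have "release I k + L k \<le> B" using single[OF k] Lsum L0 unfolding B_def by linarith
    then show ?thesis using capB[of k] by linarith
  qed
  show "2 * (\<Sum>l\<in>S. L l) \<le> lp_cap I k" if "S \<subseteq> coflows I"
  proof -
    have "(\<Sum>l\<in>S. L l) \<le> (\<Sum>l\<in>coflows I. L l)" using that by (intro sum_mono2) (auto simp: fin nn[OF L])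
    then have "2 * (\<Sum>l\<in>S. L l) \<le> B" using Lsum rsum unfolding B_def by linarith
    then show ?thesis using capB[of k] by linarith
  qed
  show "lp_cap I k' + L k \<le> lp_cap I k" if p: "(k', k) \<in> prec I"
  proof -
    have k: "k \<in> coflows I" using p v by (auto simp: valid_instance_def)
    \<comment> \<open>The inclusion is strict because \<open>k'\<close> belongs to the larger set
      and, by acyclicity, not to the smaller one.\<close>
    have "{l. (l, k') \<in> (prec I)\<^sup>+} \<subset> {l. (l, k) \<in> (prec I)\<^sup>+}"
    proof -
      have "(k', k') \<notin> (prec I)\<^sup>+" using v by (auto simp: valid_instance_def acyclic_def)
      then show ?thesis using p by (auto intro: trancl_into_trancl)
    qed
    moreover have "finite {l. (l, k) \<in> (prec I)\<^sup>+}"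
      by (rule finite_subset[OF _ fin]) (use trancl_prec_subset[OF v] in auto)
    ultimately have "card {l. (l, k') \<in> (prec I)\<^sup>+} < card {l. (l, k) \<in> (prec I)\<^sup>+}"
      by (rule psubset_card_mono[rotated])
    then have "c k' + 1 \<le> c k" by (simp add: c_def)
    then have "B * (1 + (c k' + 1)) \<le> B * (1 + c k)" by (intro mult_left_mono) (auto simp: B0)
    moreover have "L k \<le> B" using single[OF k] Lsum L0 rsum unfolding B_def by linarith
    ultimately show ?thesis unfolding cap by (simp add: distrib_left)
  qed
qed

text \<open>Release and precedence constraints survive a pointwise minimum of two solutions. For the
  volume constraints, the coflows keeping their value form a set on which the old inequality
  applies, and the capped ones are added by \<open>load_volume_extend\<close>. The value 0 outside
  \<open>coflows I\<close> confines the remaining coordinates of the function, so that all of them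
  range over compact intervals.\<close>

lemma lp_feasible_truncate:
  assumes v: "valid_instance I" and C: "lp_feasible I C"
  shows "lp_feasible I (\<lambda>k. if k \<in> coflows I then min (C k) (lp_cap I k) else 0)" (is "lp_feasible I ?C")
  unfolding lp_feasible_iff load_constraints_def
proof (intro ballI conjI allI impI)
  fix L k assume "L \<in> port_loads I" "k \<in> coflows I"
  then show "release I k + L k \<le> ?C k"
    using C lp_cap_release[OF v] by (auto simp: lp_feasible_iff load_constraints_def)
next
  fix L x assume L: "L \<in> port_loads I" and x: "x \<in> prec I"
  obtain k' k where xe: "x = (k', k)" by (cases x)
  have "k' \<in> coflows I" "k \<in> coflows I" using x v by (auto simp: valid_instance_def xe)
  moreover have "C k' + L k \<le> C k" using C L x by (auto simp: lp_feasible_iff load_constraints_def xe)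
  moreover have "lp_cap I k' + L k \<le> lp_cap I k" using lp_cap_prec[OF v L] x by (simp add: xe)
  ultimately show "case x of (k', k) \<Rightarrow> ?C k' + L k \<le> ?C k" by (auto simp: xe min_def)
next
  fix L S assume L: "L \<in> port_loads I" and S: "S \<subseteq> coflows I"
  define S1 S2 where "S1 = {k \<in> S. C k \<le> lp_cap I k}" and "S2 = {k \<in> S. \<not> C k \<le> lp_cap I k}"
  have SS: "S = S1 \<union> S2" by (auto simp: S1_def S2_def)
  have fS: "finite S" using v S by (auto simp: valid_instance_def intro: finite_subset)
  have eq: "(\<Sum>k\<in>S1. L k * ?C k) = (\<Sum>k\<in>S1. L k * C k)" using S by (intro sum.cong) (auto simp: S1_def)
  have 1: "1 / (2 * real (cores I)) * ((\<Sum>k\<in>S1. (L k)\<^sup>2) + (\<Sum>k\<in>S1. L k)\<^sup>2) \<le> (\<Sum>k\<in>S1. L k * ?C k)"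
  proof -
    have "S1 \<subseteq> coflows I" using S by (auto simp: S1_def)
    moreover have "load_constraints I L C" using C L by (simp add: lp_feasible_iff)
    ultimately show ?thesis unfolding load_constraints_def using eq by simp
  qed
  have 2: "2 * (\<Sum>k\<in>S1 \<union> S2. L k) \<le> ?C k" if "k \<in> S2" for k
    using that S lp_cap_volume[OF v L, of "S1 \<union> S2" k] unfolding SS[symmetric] by (auto simp: S2_def)
  show "1 / (2 * real (cores I)) * ((\<Sum>k\<in>S. (L k)\<^sup>2) + (\<Sum>k\<in>S. L k)\<^sup>2) \<le> (\<Sum>k\<in>S. L k * ?C k)"
    unfolding SS
    by (rule load_volume_extend[OF _ _ _ port_loads_nonneg[OF L] _ 1 2])
       (use fS v in \<open>auto simp: S1_def S2_def valid_instance_def\<close>)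
qed

lemma lp_feasible_lp_cap:
  assumes v: "valid_instance I"
  shows "lp_feasible I (lp_cap I)"
  unfolding lp_feasible_iff load_constraints_def
proof (intro ballI conjI allI impI)
  fix L S assume L: "L \<in> port_loads I" and S: "S \<subseteq> coflows I"
  \<comment> \<open>The empty set satisfies the volume inequality trivially, and all of
    \<open>S\<close> is added to it at once.\<close>
  have "1 / (2 * real (cores I)) * ((\<Sum>k\<in>{} \<union> S. (L k)\<^sup>2) + (\<Sum>k\<in>{} \<union> S. L k)\<^sup>2) \<le> (\<Sum>k\<in>{} \<union> S. L k * lp_cap I k)"
    by (rule load_volume_extend[OF _ _ _ port_loads_nonneg[OF L]])
       (use S v lp_cap_volume[OF v L S] in \<open>auto simp: valid_instance_def intro: finite_subset\<close>)
  then show "1 / (2 * real (cores I)) * ((\<Sum>k\<in>S. (L k)\<^sup>2) + (\<Sum>k\<in>S. L k)\<^sup>2) \<le> (\<Sum>k\<in>S. L k * lp_cap I k)"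
    by simp
next
  fix L x assume "L \<in> port_loads I" "x \<in> prec I"
  then show "case x of (k', k) \<Rightarrow> lp_cap I k' + L k \<le> lp_cap I k"
    by (cases x) (auto intro: lp_cap_prec[OF v])
qed (rule lp_cap_release[OF v])

section \<open>Compactness and the existence of an LP optimum\<close>

lemma compact_box_fun:
  fixes M :: "'k \<Rightarrow> real"
  shows "compact {C. \<forall>k. C k \<in> {0..M k}}"
proof -
  \<comment> \<open>This is Tychonoff's theorem, since the function type carries the product
    topology.\<close>
  have "compactin (product_topology (\<lambda>k::'k. euclidean) UNIV) (PiE UNIV (\<lambda>k. {0..M k}))"
    by (simp add: compactin_PiE)
  then show ?thesis
    by (simp add: euclidean_product_topology PiE_def Pi_def)
qed

lemma closed_lp_feasible: "closed {C. lp_feasible I C}"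
proof -
  have lin: "continuous_on UNIV (\<lambda>C :: 'a \<Rightarrow> real. C k)" for k by simp
  have "closed {C. load_constraints I L C}" for L
    unfolding load_constraints_def case_prod_unfold Ball_def
    by (intro closed_Collect_conj closed_Collect_all closed_Collect_imp closed_Collect_le
        open_Collect_const continuous_intros lin)
  then show ?thesis
    unfolding lp_feasible_iff Ball_def by (intro closed_Collect_all closed_Collect_imp open_Collect_const)
qed

text \<open>Coflows of weight zero leave the sublevel sets unbounded.  Truncating at \<^const>\<open>lp_cap\<close> preserves
  feasibility and does not increase the objective, which reduces the existence of an optimum to
  compactness.\<close>

lemma lp_optimal_exists:
  assumes v: "valid_instance I"
  shows "\<exists>C. lp_optimal I C"
proof -
  let ?w = "\<lambda>C. \<Sum>k\<in>coflows I. weight I k * C k"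
  let ?M = "\<lambda>k. if k \<in> coflows I then lp_cap I k else 0"
  let ?T = "\<lambda>C k. if k \<in> coflows I then min (C k) (lp_cap I k) else 0"
  let ?K = "{C. \<forall>k. C k \<in> {0..?M k}} \<inter> {C. lp_feasible I C}"
  have w: "0 \<le> weight I k" if "k \<in> coflows I" for k using v that by (simp add: valid_instance_def)
  have L: "in_load I 1 \<in> port_loads I" (is "?L \<in> _")
    using v by (simp add: valid_instance_def port_loads_def)
  have TK: "?T C \<in> ?K" if C: "lp_feasible I C" for C
    using lp_feasible_truncate[OF v C] lp_feasible_nonneg[OF v C] lp_cap_nonneg[OF v L] by auto
  have "compact ?K" by (intro compact_Int_closed compact_box_fun closed_lp_feasible)
  moreover have "?K \<noteq> {}" using TK[OF lp_feasible_lp_cap[OF v]] by (metis empty_iff)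
  moreover have "continuous_on ?K ?w"
    by (intro continuous_intros continuous_on_subset[OF continuous_on_product_coordinates]) auto
  ultimately obtain C where C: "C \<in> ?K" and le: "\<And>C'. C' \<in> ?K \<Longrightarrow> ?w C \<le> ?w C'"
    using continuous_attains_inf[of ?K ?w] by blast
  have "?w C \<le> ?w C'" if "lp_feasible I C'" for C'
  proof -
    have "?w C \<le> ?w (?T C')" by (rule le[OF TK[OF that]])
    also have "\<dots> \<le> ?w C'" by (intro sum_mono mult_left_mono) (auto simp: w)
    finally show ?thesis .
  qed
  then show ?thesis using C by (auto simp: lp_optimal_def)
qed

section \<open>The linear program bounds every schedule from below\<close>

lemma feasible_integrable:
  "feasible I x \<Longrightarrow> h \<in> core_set I \<Longrightarrow> f \<in> flows I \<Longrightarrow> 0 \<le> T \<Longrightarrow> x h f integrable_on {0..T}"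
  by (simp add: feasible_def)

lemma feasible_nonneg:
  "feasible I x \<Longrightarrow> h \<in> core_set I \<Longrightarrow> f \<in> flows I \<Longrightarrow> 0 \<le> t \<Longrightarrow> 0 \<le> x h f t"
  by (simp add: feasible_def)

lemma feasible_port_capacity:
  assumes "feasible I x" "p \<in> sides" "h \<in> core_set I" "i \<in> port_set I" "0 \<le> t"
  shows "(\<Sum>f | f \<in> flows I \<and> p f = i. x h f t) \<le> 1"
  using assms unfolding feasible_def sides_def by blast

lemma sent_mono:
  assumes "feasible I x" "f \<in> flows I" "0 \<le> a" "a \<le> b"
  shows "sent I x f a \<le> sent I x f b"
  unfolding sent_def
proof (rule sum_mono)
  fix h assume h: "h \<in> core_set I"
  show "integral {0..a} (x h f) \<le> integral {0..b} (x h f)"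
    by (rule integral_subset_le)
       (use assms h in \<open>auto intro: feasible_integrable feasible_nonneg\<close>)
qed

text \<open>The data sent is continuous in the time, so the times up to some \<open>T1\<close> at
  which it equals the demand form a compact set. The infimum defining the completion time is
  therefore a minimum.\<close>

lemma flow_completion_attained:
  assumes fe: "feasible I x" and f: "f \<in> flows I"
  shows flow_completion_nonneg: "0 \<le> flow_completion I x f"
    and sent_flow_completion: "sent I x f (flow_completion I x f) = flow_demand I f"
proof -
  let ?Z = "{T. T \<ge> 0 \<and> sent I x f T = flow_demand I f}"
  obtain T1 where T1: "T1 \<in> ?Z" using fe f by (auto simp: feasible_def)
  have "continuous_on {0..T1} (sent I x f)"
    unfolding sent_def using T1
    by (intro continuous_intros indefinite_integral_continuous_1 feasible_integrable[OF fe _ f]) auto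
  then have "closed ({0..T1} \<inter> sent I x f -` {flow_demand I f})"
    by (rule continuous_closed_preimage) auto
  then have "compact ({0..T1} \<inter> ({0..T1} \<inter> sent I x f -` {flow_demand I f}))"
    by (intro compact_Int_closed compact_Icc)
  also have "{0..T1} \<inter> ({0..T1} \<inter> sent I x f -` {flow_demand I f}) = ?Z \<inter> {0..T1}" by auto
  finally have cpt: "compact (?Z \<inter> {0..T1})" .
  have ne: "?Z \<inter> {0..T1} \<noteq> {}" using T1 by auto
  from compact_attains_inf[OF cpt ne]
  obtain m where m: "m \<in> ?Z \<inter> {0..T1}" and le: "\<forall>z \<in> ?Z \<inter> {0..T1}. m \<le> z"
    by (rule bexE)
  have "Inf ?Z = m"
  proof (rule cInf_eq_minimum)
    show "m \<in> ?Z" using m by simp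
    show "m \<le> z" if "z \<in> ?Z" for z
      using that bspec[OF le, of z] m by (cases "z \<le> T1") auto
  qed
  then show "0 \<le> flow_completion I x f" "sent I x f (flow_completion I x f) = flow_demand I f"
    using m by (auto simp: flow_completion_def)
qed

lemma sent_after_completion:
  assumes fe: "feasible I x" and f: "f \<in> flows I" and T: "flow_completion I x f \<le> T"
  shows "sent I x f T = flow_demand I f"
proof (rule antisym)
  have T0: "0 \<le> T" using flow_completion_nonneg[OF fe f] T by simp
  then show "sent I x f T \<le> flow_demand I f" using fe f by (auto simp: feasible_def)
  show "flow_demand I f \<le> sent I x f T"
    using sent_mono[OF fe f flow_completion_nonneg[OF fe f] T] sent_flow_completion[OF fe f] by simp
qed

lemma flow_completion_le_coflow_completion:
  assumes "valid_instance I" "f \<in> flows_of I k"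
  shows "flow_completion I x f \<le> coflow_completion I x k"
  using assms by (auto simp: coflow_completion_def intro!: Max_ge finite_flows_of)

lemma finite_ancestor_times:
  assumes v: "valid_instance I"
  shows "finite (\<Union>k'\<in>{k'. (k', k) \<in> (prec I)\<^sup>*}. insert (release I k') (flow_completion I x ` flows_of I k'))"
proof -
  \<comment> \<open>By reflexivity \<open>k\<close> is its own ancestor even when it lies outside
    \<open>coflows I\<close>.\<close>
  have "{k'. (k', k) \<in> (prec I)\<^sup>*} \<subseteq> insert k (coflows I)"
    using trancl_prec_subset[OF v] by (auto simp: rtrancl_eq_or_trancl)
  moreover have "finite (coflows I)" using v by (simp add: valid_instance_def)
  ultimately have "finite {k'. (k', k) \<in> (prec I)\<^sup>*}" by (meson finite_insert finite_subset)
  then show ?thesis by (auto intro: finite_flows_of[OF v])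
qed

lemma ancestor_times_le_empty_coflow:
  assumes v: "valid_instance I" and e: "flows_of I k = {}" and a: "(k', k) \<in> (prec I)\<^sup>*"
  shows "release I k' \<le> coflow_completion I x k"
    and "f \<in> flows_of I k' \<Longrightarrow> flow_completion I x f \<le> coflow_completion I x k"
  unfolding coflow_completion_def using e a
  by (auto intro!: Max_ge finite_ancestor_times[OF v])

text \<open>A common interface to both branches of \<open>coflow_completion\<close>: for a coflow
  with flows only its own flows matter, for an empty one the flows and releases of all
  ancestors.\<close>

lemma coflow_completion_le:
  assumes v: "valid_instance I"
    and f: "\<And>k' f. (k', k) \<in> (prec I)\<^sup>* \<Longrightarrow> f \<in> flows_of I k' \<Longrightarrow> flows_of I k = {} \<or> k' = k \<Longrightarrow> flow_completion I x f \<le> T"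
    and r: "\<And>k'. (k', k) \<in> (prec I)\<^sup>* \<Longrightarrow> flows_of I k = {} \<Longrightarrow> release I k' \<le> T"
  shows "coflow_completion I x k \<le> T"
proof (cases "flows_of I k = {}")
  case False
  then show ?thesis using f[of k] finite_flows_of[OF v] by (auto simp: coflow_completion_def)
next
  case True
  have "(\<Union>k'\<in>{k'. (k', k) \<in> (prec I)\<^sup>*}. insert (release I k') (flow_completion I x ` flows_of I k')) \<noteq> {}"
    by blast
  then show ?thesis using True f r
    unfolding coflow_completion_def by (auto simp: Max_le_iff[OF finite_ancestor_times[OF v]])
qed

lemma coflow_completion_nonneg:
  assumes v: "valid_instance I" and fe: "feasible I x" and k: "k \<in> coflows I"
  shows "0 \<le> coflow_completion I x k"
proof (cases "flows_of I k = {}")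
  case True
  have "0 \<le> release I k" using v k by (simp add: valid_instance_def)
  also have "\<dots> \<le> coflow_completion I x k"
    by (rule ancestor_times_le_empty_coflow(1)[OF v True]) simp
  finally show ?thesis .
next
  case False
  then obtain f where f: "f \<in> flows_of I k" by blast
  have "0 \<le> flow_completion I x f"
    using flow_completion_nonneg[OF fe] f by (simp add: flows_of_def)
  also have "\<dots> \<le> coflow_completion I x k" by (rule flow_completion_le_coflow_completion[OF v f])
  finally show ?thesis .
qed

text \<open>All data of \<open>Q\<close> at the port passes through core \<open>h\<close> during
  \<open>{s..T}\<close>, where the port has rate at most 1. Integrating that rate bounds the load by
  the length of the window. With \<open>s = 0\<close> this yields the volume constraints; with
  \<open>Q\<close> a singleton it yields the release and precedence constraints.\<close>

lemma core_load_le: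
  assumes v: "valid_instance I" and fe: "feasible I x" and L: "L \<in> port_loads I"
    and h: "h \<in> core_set I" and Q: "Q \<subseteq> coflows I" and s: "0 \<le> s" "s \<le> T"
    and only: "\<And>k f h' t. k \<in> Q \<Longrightarrow> f \<in> flows_of I k \<Longrightarrow> h' \<in> core_set I \<Longrightarrow> h' \<noteq> h \<Longrightarrow> 0 \<le> t \<Longrightarrow> x h' f t = 0"
    and idle: "\<And>k f t. k \<in> Q \<Longrightarrow> f \<in> flows_of I k \<Longrightarrow> 0 \<le> t \<Longrightarrow> t < s \<Longrightarrow> x h f t = 0"
    and fin: "\<And>k. k \<in> Q \<Longrightarrow> coflow_completion I x k \<le> T"
  shows "(\<Sum>k\<in>Q. L k) \<le> T - s"
proof -
  obtain p i where p: "p \<in> sides" and i: "i \<in> port_set I"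
    and Lk: "\<forall>k\<in>coflows I. L k = (\<Sum>f | f \<in> flows_of I k \<and> p f = i. flow_demand I f)"
    by (rule port_loadsE[OF L])
  let ?G = "{f. f \<in> flows I \<and> coflow_of f \<in> Q \<and> p f = i}"
  have finG: "finite ?G" by (rule finite_subset[OF _ finite_flows[OF v]]) auto
  have int: "x h' f integrable_on {0..T}" if "f \<in> ?G" "h' \<in> core_set I" for f h'
    using feasible_integrable[OF fe] that s by auto
  have dem: "flow_demand I f = integral {0..T} (x h f)" if f: "f \<in> ?G" for f
  proof -
    have fk: "f \<in> flows_of I (coflow_of f)" using f by (simp add: flows_of_def)
    have z: "integral {0..T} (x h' f) = 0" if h': "h' \<in> core_set I" "h' \<noteq> h" for h'
    proof -
      have "integral {0..T} (x h' f) = integral {0..T} (\<lambda>_. 0)"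
        by (rule integral_cong) (use only[OF _ fk] f h' in auto)
      then show ?thesis by simp
    qed
    have "flow_demand I f = sent I x f T"
      using sent_after_completion[OF fe, of f T] f fin[of "coflow_of f"]
        flow_completion_le_coflow_completion[OF v fk, of x] by auto
    also have "\<dots> = (\<Sum>h'\<in>{h}. integral {0..T} (x h' f))"
      unfolding sent_def by (rule sum.mono_neutral_right) (use h z in auto)
    finally show ?thesis by simp
  qed
  have win: "((\<lambda>t. if t \<in> {s..T} then 1 else (0::real)) has_integral T - s) {0..T}"
    using has_integral_const_real[of "1::real" s T] s by (subst has_integral_restrict) auto
  have "(\<Sum>k\<in>Q. L k) = (\<Sum>k\<in>Q. \<Sum>f | f \<in> flows_of I k \<and> p f = i. flow_demand I f)"
    using Q Lk by (intro sum.cong) auto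
  also have "\<dots> = (\<Sum>f\<in>?G. flow_demand I f)" by (rule sum_flows_by_coflow[OF v Q])
  also have "\<dots> = (\<Sum>f\<in>?G. integral {0..T} (x h f))" by (rule sum.cong) (use dem in auto)
  also have "\<dots> = integral {0..T} (\<lambda>t. \<Sum>f\<in>?G. x h f t)"
    by (rule integral_sum[symmetric]) (use finG int h in auto)
  also have "\<dots> \<le> integral {0..T} (\<lambda>t. if t \<in> {s..T} then 1 else 0)"
  proof (rule integral_le)
    show "(\<lambda>t. \<Sum>f\<in>?G. x h f t) integrable_on {0..T}"
      by (rule integrable_sum) (use finG int h in auto)
    show "(\<lambda>t. if t \<in> {s..T} then 1 else (0::real)) integrable_on {0..T}"
      using win by (rule has_integral_integrable)
  next
    fix t assume t: "t \<in> {0..T}"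
    show "(\<Sum>f\<in>?G. x h f t) \<le> (if t \<in> {s..T} then 1 else 0)"
    proof (cases "t < s")
      case True
      have "x h f t = 0" if "f \<in> ?G" for f
        using idle[of "coflow_of f" f t] that t True by (auto simp: flows_of_def)
      then show ?thesis using True by simp
    next
      case False
      \<comment> \<open>The port capacity speaks of all flows at the port; those of coflows outside
        \<open>Q\<close> have nonnegative rates.\<close>
      have "(\<Sum>f\<in>?G. x h f t) \<le> (\<Sum>f | f \<in> flows I \<and> p f = i. x h f t)"
        by (rule sum_mono2) (use finite_flows[OF v] feasible_nonneg[OF fe h] t in auto)
      also have "\<dots> \<le> 1" by (rule feasible_port_capacity[OF fe p h i]) (use t in auto)
      finally show ?thesis using False t by auto
    qed
  qed
  also have "\<dots> = T - s"
    using win by (rule integral_unique)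
  finally show ?thesis .
qed

text \<open>A flow that completed before \<open>s\<close> would have sent nothing by then, whereas
  its demand is positive.\<close>

lemma start_before_completion:
  assumes v: "valid_instance I" and fe: "feasible I x" and f: "f \<in> flows_of I k"
    and idle: "\<And>h t. h \<in> core_set I \<Longrightarrow> 0 \<le> t \<Longrightarrow> t < s \<Longrightarrow> x h f t = 0"
  shows "s \<le> coflow_completion I x k"
proof (rule ccontr)
  assume "\<not> s \<le> coflow_completion I x k"
  then have lt: "flow_completion I x f < s"
    using flow_completion_le_coflow_completion[OF v f, of x] by linarith
  have ff: "f \<in> flows I" using f by (simp add: flows_of_def)
  have "integral {0..flow_completion I x f} (x h f) = 0" if "h \<in> core_set I" for h
  proof -
    have "integral {0..flow_completion I x f} (x h f) = integral {0..flow_completion I x f} (\<lambda>_. 0)"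
      by (rule integral_cong) (use idle[OF that] lt in auto)
    then show ?thesis by simp
  qed
  then have "sent I x f (flow_completion I x f) = 0" by (simp add: sent_def)
  then show False using sent_flow_completion[OF fe ff] flow_demand_pos[OF ff] by simp
qed

text \<open>Summing \<open>L k\<close> times the hypothesis counts the product
  \<open>L k * L l\<close> for every ordered pair with \<open>C l \<le> C k\<close>. Any two coflows
  are comparable, so doubling this sum covers the full square of the total load and, on the
  diagonal, the extra squares.\<close>

lemma single_machine_volume:
  fixes L C :: "'a \<Rightarrow> real"
  assumes fin: "finite Q" and nn: "\<And>k. 0 \<le> L k"
    and C: "\<And>k. k \<in> Q \<Longrightarrow> (\<Sum>l | l \<in> Q \<and> C l \<le> C k. L l) \<le> C k"
  shows "((\<Sum>k\<in>Q. (L k)\<^sup>2) + (\<Sum>k\<in>Q. L k)\<^sup>2) / 2 \<le> (\<Sum>k\<in>Q. L k * C k)"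
proof -
  let ?b = "\<lambda>k l. if C l \<le> C k then L k * L l else 0"
  have D: "(\<Sum>k\<in>Q. \<Sum>l\<in>Q. ?b k l) \<le> (\<Sum>k\<in>Q. L k * C k)"
  proof (rule sum_mono)
    fix k assume k: "k \<in> Q"
    have "(\<Sum>l\<in>Q. ?b k l) = (\<Sum>l | l \<in> Q \<and> C l \<le> C k. L k * L l)"
      using fin by (simp add: sum.If_cases Collect_conj_eq)
    also have "\<dots> = L k * (\<Sum>l | l \<in> Q \<and> C l \<le> C k. L l)" by (simp add: sum_distrib_left)
    also have "\<dots> \<le> L k * C k" by (rule mult_left_mono[OF C[OF k] nn])
    finally show "(\<Sum>l\<in>Q. ?b k l) \<le> L k * C k" .
  qed
  have "(\<Sum>k\<in>Q. (L k)\<^sup>2) + (\<Sum>k\<in>Q. L k)\<^sup>2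
      = (\<Sum>k\<in>Q. \<Sum>l\<in>Q. if l = k then L k * L l else 0) + (\<Sum>k\<in>Q. \<Sum>l\<in>Q. L k * L l)"
    using fin by (simp add: power2_eq_square sum_product)
  also have "\<dots> = (\<Sum>k\<in>Q. \<Sum>l\<in>Q. (if l = k then L k * L l else 0) + L k * L l)"
    by (simp add: sum.distrib)
  \<comment> \<open>For each pair at least one of the two summands equals \<open>L k * L l\<close>,
    and on the diagonal both do.\<close>
  also have "\<dots> \<le> (\<Sum>k\<in>Q. \<Sum>l\<in>Q. ?b k l + ?b l k)"
    by (intro sum_mono) (auto simp: nn mult.commute)
  also have "\<dots> = (\<Sum>k\<in>Q. \<Sum>l\<in>Q. ?b k l) + (\<Sum>k\<in>Q. \<Sum>l\<in>Q. ?b l k)"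
    by (simp add: sum.distrib)
  also have "(\<Sum>k\<in>Q. \<Sum>l\<in>Q. ?b l k) = (\<Sum>k\<in>Q. \<Sum>l\<in>Q. ?b k l)"
    by (rule sum.swap)
  finally have "(\<Sum>k\<in>Q. (L k)\<^sup>2) + (\<Sum>k\<in>Q. L k)\<^sup>2 \<le> (\<Sum>k\<in>Q. L k * C k) + (\<Sum>k\<in>Q. L k * C k)"
    by (rule order_trans) (rule add_mono[OF D D])
  then show ?thesis by simp
qed

text \<open>Cauchy-Schwarz gives that the square of the total load is at most \<open>m\<close> times
  the sum of the squared loads of the groups. The sum of the individual squares merely shrinks when
  divided by \<open>m \<ge> 1\<close>.\<close>

lemma parallel_machine_volume:
  fixes L C :: "'a \<Rightarrow> real"
  assumes fin: "finite S" "finite H" and c: "c ` S \<subseteq> H" and m: "m = real (card H)" "m > 0"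
    and vol: "\<And>h. h \<in> H \<Longrightarrow> ((\<Sum>k | k \<in> S \<and> c k = h. (L k)\<^sup>2) + (\<Sum>k | k \<in> S \<and> c k = h. L k)\<^sup>2) / 2
       \<le> (\<Sum>k | k \<in> S \<and> c k = h. L k * C k)"
  shows "1 / (2 * m) * ((\<Sum>k\<in>S. (L k)\<^sup>2) + (\<Sum>k\<in>S. L k)\<^sup>2) \<le> (\<Sum>k\<in>S. L k * C k)"
proof -
  have split: "(\<Sum>k\<in>S. g k) = (\<Sum>h\<in>H. \<Sum>k | k \<in> S \<and> c k = h. g k)" for g :: "'a \<Rightarrow> real"
    by (rule sum.group[symmetric, OF fin c])
  let ?l = "\<lambda>h. \<Sum>k | k \<in> S \<and> c k = h. L k"
  have q: "0 \<le> (\<Sum>k\<in>S. (L k)\<^sup>2)" by (simp add: sum_nonneg)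
  have m1: "m \<ge> 1" using m by simp
  have "(\<Sum>k\<in>S. (L k)\<^sup>2) / m \<le> (\<Sum>k\<in>S. (L k)\<^sup>2)"
    using divide_left_mono[OF m1 q] m by simp
  moreover have "(\<Sum>k\<in>S. L k)\<^sup>2 / m \<le> (\<Sum>h\<in>H. (?l h)\<^sup>2)"
    using sum_squared_le_sum_of_squares[of ?l H] m unfolding split[of L] by (simp add: field_simps)
  moreover have "1 / (2 * m) * ((\<Sum>k\<in>S. (L k)\<^sup>2) + (\<Sum>k\<in>S. L k)\<^sup>2)
      = ((\<Sum>k\<in>S. (L k)\<^sup>2) / m + (\<Sum>k\<in>S. L k)\<^sup>2 / m) / 2"
    by (simp add: add_divide_distrib)
  ultimately have "1 / (2 * m) * ((\<Sum>k\<in>S. (L k)\<^sup>2) + (\<Sum>k\<in>S. L k)\<^sup>2)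
      \<le> ((\<Sum>k\<in>S. (L k)\<^sup>2) + (\<Sum>h\<in>H. (?l h)\<^sup>2)) / 2"
    by simp
  also have "\<dots> = (\<Sum>h\<in>H. ((\<Sum>k | k \<in> S \<and> c k = h. (L k)\<^sup>2) + (?l h)\<^sup>2) / 2)"
    unfolding split[of "\<lambda>k. (L k)\<^sup>2"] by (simp add: sum.distrib sum_divide_distrib[symmetric])
  also have "\<dots> \<le> (\<Sum>k\<in>S. L k * C k)" unfolding split[of "\<lambda>k. L k * C k"] by (rule sum_mono[OF vol])
  finally show ?thesis .
qed

text \<open>Indivisibility gives each coflow a core \<open>c k\<close>. Release and precedence
  constraints share one reason, isolated as \<open>start\<close>: if \<open>k\<close> sends nothing
  before \<open>s\<close>, the port still needs \<open>L k\<close> time on that core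
  afterwards.\<close>

lemma lp_feasible_coflow_completion:
  assumes v: "valid_instance I" and fe: "feasible I x" and ind: "indivisible I x"
  shows "lp_feasible I (coflow_completion I x)"
proof -
  let ?C = "coflow_completion I x"
  obtain c where c: "\<And>k. k \<in> coflows I \<Longrightarrow> c k \<in> core_set I"
    and only: "\<And>k h f t. k \<in> coflows I \<Longrightarrow> h \<in> core_set I \<Longrightarrow> h \<noteq> c k \<Longrightarrow> f \<in> flows_of I k \<Longrightarrow> 0 \<le> t \<Longrightarrow> x h f t = 0"
  proof -
    have "\<forall>k\<in>coflows I. \<exists>h. h \<in> core_set I \<and> (\<forall>h'\<in>core_set I. h' \<noteq> h \<longrightarrow> (\<forall>f\<in>flows_of I k. \<forall>t\<ge>0. x h' f t = 0))"
      using ind unfolding indivisible_def by blast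
    from bchoice[OF this] obtain c where
      "\<forall>k\<in>coflows I. c k \<in> core_set I \<and> (\<forall>h'\<in>core_set I. h' \<noteq> c k \<longrightarrow> (\<forall>f\<in>flows_of I k. \<forall>t\<ge>0. x h' f t = 0))"
      by (rule exE)
    then show ?thesis by (intro that[of c]) auto
  qed
  have start: "s + L k \<le> ?C k"
    if L: "L \<in> port_loads I" and k: "k \<in> coflows I" and s: "0 \<le> s"
      and idle: "\<And>f h t. f \<in> flows_of I k \<Longrightarrow> h \<in> core_set I \<Longrightarrow> 0 \<le> t \<Longrightarrow> t < s \<Longrightarrow> x h f t = 0"
      and empty: "flows_of I k = {} \<Longrightarrow> s \<le> ?C k" for L k s
  proof -
    have "s \<le> ?C k"
    proof (cases "flows_of I k = {}")
      case False
      then obtain f where f: "f \<in> flows_of I k" by blast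
      show ?thesis by (rule start_before_completion[OF v fe f idle[OF f]])
    qed (rule empty)
    then have "(\<Sum>k\<in>{k}. L k) \<le> ?C k - s"
      by (intro core_load_le[OF v fe L c[OF k]]) (use k s only idle[OF _ c[OF k]] in auto)
    then show ?thesis by simp
  qed
  show ?thesis unfolding lp_feasible_iff load_constraints_def
  proof (intro ballI conjI allI impI)
    fix L k assume L: "L \<in> port_loads I" and k: "k \<in> coflows I"
    show "release I k + L k \<le> ?C k"
    proof (rule start[OF L k])
      show "0 \<le> release I k" using v k by (simp add: valid_instance_def)
      show "release I k \<le> ?C k" if "flows_of I k = {}"
        by (rule ancestor_times_le_empty_coflow(1)[OF v that]) simp
      fix f h t assume "f \<in> flows_of I k" "h \<in> core_set I" "0 \<le> t" "t < release I k"
      then show "x h f t = 0" using fe by (auto simp: feasible_def flows_of_def)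
    qed
  next
    fix L e assume L: "L \<in> port_loads I" and e: "e \<in> prec I"
    obtain k' k where ee: "e = (k', k)" by (cases e)
    have k: "k \<in> coflows I" "k' \<in> coflows I" using e v by (auto simp: ee valid_instance_def)
    have "?C k' + L k \<le> ?C k"
    proof (rule start[OF L k(1)])
      show "0 \<le> ?C k'" by (rule coflow_completion_nonneg[OF v fe k(2)])
      \<comment> \<open>No flow of \<open>k\<close> can witness this when \<open>k\<close> is empty,
        but its completion time then ranges over all its ancestors, among them those of
        \<open>k'\<close>.\<close>
      show "?C k' \<le> ?C k" if em: "flows_of I k = {}"
      proof (rule coflow_completion_le[OF v])
        fix a assume "(a, k') \<in> (prec I)\<^sup>*"
        then have a: "(a, k) \<in> (prec I)\<^sup>*" using e by (simp add: ee rtrancl_into_rtrancl)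
        show "release I a \<le> ?C k" by (rule ancestor_times_le_empty_coflow(1)[OF v em a])
        show "flow_completion I x f \<le> ?C k" if "f \<in> flows_of I a" for f
          by (rule ancestor_times_le_empty_coflow(2)[OF v em a that])
      qed
      fix f h t assume "f \<in> flows_of I k" "h \<in> core_set I" "0 \<le> t" "t < ?C k'"
      then show "x h f t = 0" using fe e unfolding ee feasible_def by blast
    qed
    then show "case e of (k', k) \<Rightarrow> ?C k' + L k \<le> ?C k" by (simp add: ee)
  next
    fix L S assume L: "L \<in> port_loads I" and S: "S \<subseteq> coflows I"
    have fS: "finite S" using v S by (auto simp: valid_instance_def intro: finite_subset)
    show "1 / (2 * real (cores I)) * ((\<Sum>k\<in>S. (L k)\<^sup>2) + (\<Sum>k\<in>S. L k)\<^sup>2) \<le> (\<Sum>k\<in>S. L k * ?C k)"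
    proof (rule parallel_machine_volume[where H = "core_set I" and c = c])
      fix h assume h: "h \<in> core_set I"
      show "((\<Sum>k | k \<in> S \<and> c k = h. (L k)\<^sup>2) + (\<Sum>k | k \<in> S \<and> c k = h. L k)\<^sup>2) / 2
        \<le> (\<Sum>k | k \<in> S \<and> c k = h. L k * ?C k)"
      proof (rule single_machine_volume)
        fix k assume k: "k \<in> {k. k \<in> S \<and> c k = h}"
        \<comment> \<open>All coflows summed here complete by \<open>?C k\<close> on the same core,
          so the window is the whole time from 0 to \<open>?C k\<close>.\<close>
        have "(\<Sum>l | l \<in> {k. k \<in> S \<and> c k = h} \<and> ?C l \<le> ?C k. L l) \<le> ?C k - 0"
          by (rule core_load_le[OF v fe L h])
             (use S k only coflow_completion_nonneg[OF v fe] in auto)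
        then show "(\<Sum>l | l \<in> {k. k \<in> S \<and> c k = h} \<and> ?C l \<le> ?C k. L l) \<le> ?C k" by simp
      qed (use fS port_loads_nonneg[OF L] in auto)
    qed (use fS S c v in \<open>auto simp: valid_instance_def\<close>)
  qed
qed

lemma lp_optimal_le_total:
  assumes "valid_instance I" "lp_optimal I C" "feasible I x" "indivisible I x"
  shows "(\<Sum>k\<in>coflows I. weight I k * C k) \<le> total_weighted_completion I x"
  using assms lp_feasible_coflow_completion[of I x]
  by (auto simp: lp_optimal_def total_weighted_completion_def)

section \<open>Greedy matchings and the existence of runs\<close>

lemma greedy_superset: "F \<subseteq> greedy fs F"
  by (induction fs arbitrary: F) fastforce+

lemma greedy_subset: "greedy fs F \<subseteq> F \<union> set fs"
proof (induction fs arbitrary: F)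
  case (Cons f fs)
  show ?case using Cons[of F] Cons[of "insert f F"] by auto
qed simp

text \<open>A matching between input and output ports, expressed as injectivity of both projections
  in \<open>sides\<close> so that later arguments need not distinguish the two sides.\<close>

definition port_disjoint :: "'k flow set \<Rightarrow> bool" where
  "port_disjoint F \<longleftrightarrow> (\<forall>p\<in>sides. inj_on p F)"

lemma greedy_port_disjoint: "port_disjoint F \<Longrightarrow> port_disjoint (greedy fs F)"
proof (induction fs arbitrary: F)
  case (Cons f fs)
  show ?case
  proof (cases "\<forall>g\<in>F. input_of g \<noteq> input_of f \<and> output_of g \<noteq> output_of f")
    case True
    then have "port_disjoint (insert f F)"
      using Cons.prems by (force simp: port_disjoint_def sides_def)
    then show ?thesis using True Cons.IH by simp
  qed (use Cons in auto)
qed simp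

text \<open>A flow is skipped only on a port conflict with a flow already chosen. Chosen flows are
  never removed, and each was either in the initial set or listed earlier. The arbitrary initial set
  \<open>F\<close> carries the induction.\<close>

lemma greedy_blocked:
  assumes "sorted_wrt P fs" "f \<in> set fs"
  shows "f \<in> greedy fs F \<or>
    (\<exists>g\<in>greedy fs F. (input_of g = input_of f \<or> output_of g = output_of f) \<and> (g \<in> F \<or> P g f))"
  using assms
proof (induction fs arbitrary: F)
  case (Cons a fs)
  show ?case
  proof (cases "f = a")
    case True
    show ?thesis
    proof (cases "\<forall>g\<in>F. input_of g \<noteq> input_of a \<and> output_of g \<noteq> output_of a")
      case free: True
      then have "f \<in> greedy (a # fs) F" using greedy_superset[of "insert a F" fs] True by auto
      then show ?thesis ..
    next
      case False
      then show ?thesis using greedy_superset[of F "a # fs"] True by (meson subsetD)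
    qed
  next
    case False
    then have f: "f \<in> set fs" "sorted_wrt P fs" "P a f" using Cons.prems by auto
    show ?thesis using Cons.IH[OF f(2,1), of F] Cons.IH[OF f(2,1), of "insert a F"] f(3) by auto
  qed
qed simp

lemma available_subset: "available I B t rem \<subseteq> flows I"
  by (auto simp: available_def)

lemma scheduled_exists:
  assumes v: "valid_instance I"
  shows "\<exists>F. scheduled I C A t rem F"
proof -
  have "\<exists>fs. distinct fs \<and> set fs = available I (A h) t rem \<and>
        sorted_wrt (\<lambda>f g. C (coflow_of f) \<le> C (coflow_of g)) fs" for h
  proof -
    have "finite (available I (A h) t rem)"
      using finite_subset[OF available_subset finite_flows[OF v]] .
    then obtain fs where fs: "set fs = available I (A h) t rem" "distinct fs"
      using finite_distinct_list by blast
    have "sorted_wrt (\<lambda>f g. C (coflow_of f) \<le> C (coflow_of g)) (sort_key (\<lambda>f. C (coflow_of f)) fs)"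
      using sorted_sort_key[of "\<lambda>f. C (coflow_of f)" fs] by (simp add: sorted_map)
    then show ?thesis using fs by (intro exI[of _ "sort_key (\<lambda>f. C (coflow_of f)) fs"]) simp
  qed
  then obtain l where "\<And>h. distinct (l h) \<and> set (l h) = available I (A h) t rem \<and>
        sorted_wrt (\<lambda>f g. C (coflow_of f) \<le> C (coflow_of g)) (l h)" by metis
  then have "scheduled I C A t rem (\<lambda>h. greedy (l h) {})" unfolding scheduled_def by blast
  then show ?thesis by blast
qed

lemma scheduled_available:
  "scheduled I C A t rem F \<Longrightarrow> h \<in> core_set I \<Longrightarrow> F h \<subseteq> available I (A h) t rem"
  unfolding scheduled_def using greedy_subset by fastforce

lemma scheduled_port_disjoint:
  assumes "scheduled I C A t rem F" "h \<in> core_set I"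
  shows "port_disjoint (F h)"
proof -
  obtain fs where "F h = greedy fs {}" using assms unfolding scheduled_def by blast
  then show ?thesis using greedy_port_disjoint[of "{}" fs] by (simp add: port_disjoint_def)
qed

text \<open>The witness may be \<open>f\<close> itself, so a flow being transmitted and a flow being
  blocked are handled by one statement.\<close>

lemma scheduled_blocked:
  assumes "scheduled I C A t rem F" "h \<in> core_set I" "f \<in> available I (A h) t rem"
  shows "\<exists>g\<in>F h. (input_of g = input_of f \<or> output_of g = output_of f) \<and> C (coflow_of g) \<le> C (coflow_of f)"
proof -
  obtain fs where fs: "set fs = available I (A h) t rem" "F h = greedy fs {}"
    "sorted_wrt (\<lambda>f g. C (coflow_of f) \<le> C (coflow_of g)) fs"
    using assms unfolding scheduled_def by blast
  have "f \<in> set fs" using fs(1) assms(3) by simp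
  from greedy_blocked[OF fs(3) this, of "{}"] show ?thesis unfolding fs(2) by auto
qed

text \<open>A valid schedule is fixed once for every possible state, which turns the relation into a
  deterministic step function that is then iterated from the initial state.\<close>

lemma transmission_run_exists:
  assumes v: "valid_instance I"
  shows "\<exists>tm rem F. transmission_run I C A tm rem F"
proof -
  obtain S where S: "\<And>t r. scheduled I C A t r (S t r)" using scheduled_exists[OF v] by metis
  define step where "step s = (case s of (t, r) \<Rightarrow>
    if \<forall>f\<in>flows I. r f = 0 then (t, r)
    else (t + time_to_event I t r (S t r),
          (\<lambda>f. if f \<in> (\<Union>h\<in>core_set I. S t r h) then r f - time_to_event I t r (S t r) else r f)))" for s
  define st where "st n = (step ^^ n) (0, flow_demand I)" for n
  have st0: "st 0 = (0, flow_demand I)" and stS: "st (Suc n) = step (st n)" for n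
    by (simp_all add: st_def)
  have "transmission_run I C A (\<lambda>n. fst (st n)) (\<lambda>n. snd (st n)) (\<lambda>n. S (fst (st n)) (snd (st n)))"
    unfolding transmission_run_def
  proof (intro conjI allI)
    fix n
    show "if \<forall>f\<in>flows I. snd (st n) f = 0
          then fst (st (Suc n)) = fst (st n) \<and> snd (st (Suc n)) = snd (st n)
          else scheduled I C A (fst (st n)) (snd (st n)) (S (fst (st n)) (snd (st n))) \<and>
               fst (st (Suc n)) = fst (st n) + time_to_event I (fst (st n)) (snd (st n)) (S (fst (st n)) (snd (st n))) \<and>
               snd (st (Suc n)) = (\<lambda>f. if f \<in> (\<Union>h\<in>core_set I. S (fst (st n)) (snd (st n)) h)
                                  then snd (st n) f - time_to_event I (fst (st n)) (snd (st n)) (S (fst (st n)) (snd (st n)))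
                                  else snd (st n) f)"
      unfolding stS step_def by (cases "st n") (auto simp: S)
  qed (simp_all add: st0)
  then show ?thesis by blast
qed

lemma assignment_run_exists:
  assumes v: "valid_instance I"
  shows "\<exists>lI lO A. assignment_run I ks lI lO A"
proof (induction ks rule: rev_induct)
  case Nil
  show ?case by (blast intro: assignment_run.init)
next
  case (snoc k ks)
  then obtain lI lO A where run: "assignment_run I ks lI lO A" by blast
  have "finite (core_set I)" "core_set I \<noteq> {}" using v by (auto simp: valid_instance_def)
  from ex_is_arg_min_if_finite[OF this] show ?case
    using assignment_run.assign[OF run] by blast
qed

lemma assignment_run_partition:
  assumes "assignment_run I ks lI lO A" "distinct ks"
  shows "A h \<subseteq> set ks"
    and "k \<in> set ks \<Longrightarrow> \<exists>h\<in>core_set I. k \<in> A h"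
    and "k \<in> A h \<Longrightarrow> k \<in> A h' \<Longrightarrow> h = h'"
proof -
  have "(\<forall>h. A h \<subseteq> set ks) \<and> (\<forall>k\<in>set ks. \<exists>h\<in>core_set I. k \<in> A h) \<and> (\<forall>h h' k. k \<in> A h \<longrightarrow> k \<in> A h' \<longrightarrow> h = h')"
    using assms
  proof (induction rule: assignment_run.induct)
    case (assign ks lI lO A k0 h0)
    have h0: "h0 \<in> core_set I" using assign.hyps(2) by (simp add: is_arg_min_def)
    have k0: "k0 \<notin> set ks" and d: "distinct ks" using assign.prems by auto
    note IH = assign.IH[OF d]
    have 1: "\<forall>h. (A(h0 := insert k0 (A h0))) h \<subseteq> set (ks @ [k0])" using IH by auto
    have 2: "\<forall>k\<in>set (ks @ [k0]). \<exists>h\<in>core_set I. k \<in> (A(h0 := insert k0 (A h0))) h"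
      using IH h0 by (auto; metis)
    have "k0 \<notin> A h" for h using IH k0 by blast
    then have 3: "\<forall>h h' k. k \<in> (A(h0 := insert k0 (A h0))) h \<longrightarrow> k \<in> (A(h0 := insert k0 (A h0))) h' \<longrightarrow> h = h'"
      using IH by (auto split: if_splits)
    show ?case using 1 2 3 by blast
  qed simp
  then show "A h \<subseteq> set ks" "k \<in> set ks \<Longrightarrow> \<exists>h\<in>core_set I. k \<in> A h"
    "k \<in> A h \<Longrightarrow> k \<in> A h' \<Longrightarrow> h = h'" by blast+
qed

lemma list_scheduling_exists:
  assumes v: "valid_instance I"
  shows "\<exists>x. coflow_driven_list_scheduling I x"
proof -
  obtain C where C: "lp_optimal I C" using lp_optimal_exists[OF v] by blast
  have "finite (coflows I)" using v by (simp add: valid_instance_def)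
  then obtain ks0 where ks0: "set ks0 = coflows I" "distinct ks0" using finite_distinct_list by blast
  define ks where "ks = sort_key C ks0"
  have ks: "distinct ks" "set ks = coflows I" "sorted_wrt (\<lambda>k k'. C k \<le> C k') ks"
    using ks0 sorted_sort_key[of C ks0] by (simp_all add: ks_def sorted_map)
  obtain lI lO A where A: "assignment_run I ks lI lO A" using assignment_run_exists[OF v] by blast
  obtain tm rem F where "transmission_run I C A tm rem F" using transmission_run_exists[OF v] by blast
  then show ?thesis unfolding coflow_driven_list_scheduling_def using C ks A by blast
qed

section \<open>Runs of the transmission phase\<close>

text \<open>The result of the assignment phase enters as the property that every coflow lies on one
  and only one core. \<open>C\<close> supplies the listing order; LP feasibility is assumed later,
  where times are bounded.\<close>

locale transmission =
  fixes I :: "'k coflow_instance" and C :: "'k \<Rightarrow> real" and A :: "nat \<Rightarrow> 'k set"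
    and tm :: "nat \<Rightarrow> real" and rem :: "nat \<Rightarrow> 'k flow \<Rightarrow> real" and F :: "nat \<Rightarrow> nat \<Rightarrow> 'k flow set"
  assumes valid: "valid_instance I"
    and assigned: "k \<in> coflows I \<Longrightarrow> \<exists>h\<in>core_set I. k \<in> A h"
    and assigned_unique: "k \<in> A h \<Longrightarrow> k \<in> A h' \<Longrightarrow> h = h'"
    and run: "transmission_run I C A tm rem F"
begin

definition finished :: "nat \<Rightarrow> bool" where
  "finished n \<longleftrightarrow> (\<forall>f\<in>flows I. rem n f = 0)"

definition active :: "nat \<Rightarrow> 'k flow set" where
  "active n = (\<Union>h\<in>core_set I. F n h)"

definition events :: "nat \<Rightarrow> real set" where
  "events n = rem n ` active n \<union> {release I k - tm n | k. k \<in> coflows I \<and> release I k > tm n}"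

section \<open>Progress and termination of the events\<close>

lemma tm_0: "tm 0 = 0" and rem_0: "rem 0 = flow_demand I"
  using run by (simp_all add: transmission_run_def)

lemma run_finished:
  assumes "finished n"
  shows "tm (Suc n) = tm n" "rem (Suc n) = rem n"
  using run assms unfolding transmission_run_def finished_def by presburger+

lemma run_step:
  assumes "\<not> finished n"
  shows scheduled_step: "scheduled I C A (tm n) (rem n) (F n)"
    and tm_step: "tm (Suc n) = tm n + Min (events n)"
    and rem_step: "rem (Suc n) = (\<lambda>f. if f \<in> active n then rem n f - Min (events n) else rem n f)"
proof -
  have "time_to_event I (tm n) (rem n) (F n) = Min (events n)"
    by (simp add: time_to_event_def events_def active_def)
  moreover have "scheduled I C A (tm n) (rem n) (F n) \<and>
      tm (Suc n) = tm n + time_to_event I (tm n) (rem n) (F n) \<and>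
      rem (Suc n) = (\<lambda>f. if f \<in> (\<Union>h\<in>core_set I. F n h)
                         then rem n f - time_to_event I (tm n) (rem n) (F n) else rem n f)"
    using run assms unfolding transmission_run_def finished_def by presburger
  ultimately show "scheduled I C A (tm n) (rem n) (F n)" "tm (Suc n) = tm n + Min (events n)"
    "rem (Suc n) = (\<lambda>f. if f \<in> active n then rem n f - Min (events n) else rem n f)"
    by (simp_all add: active_def cong: if_cong)
qed

lemma transmitted_available:
  "\<not> finished n \<Longrightarrow> h \<in> core_set I \<Longrightarrow> f \<in> F n h \<Longrightarrow> f \<in> available I (A h) (tm n) (rem n)"
  using scheduled_available[OF scheduled_step] by blast

lemma active_flow: "\<not> finished n \<Longrightarrow> f \<in> active n \<Longrightarrow> f \<in> flows I \<and> 0 < rem n f"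
  unfolding active_def using transmitted_available[of n _ f] by (auto simp: available_def)

lemma finite_events: "\<not> finished n \<Longrightarrow> finite (events n)"
proof -
  assume "\<not> finished n"
  then have "active n \<subseteq> flows I" using active_flow by blast
  then have "finite (active n)" using finite_flows[OF valid] finite_subset by blast
  moreover have "finite (coflows I)" using valid by (simp add: valid_instance_def)
  ultimately show ?thesis unfolding events_def by simp
qed

lemma rem_nonneg: "f \<in> flows I \<Longrightarrow> 0 \<le> rem n f"
proof (induction n)
  case 0
  then show ?case by (simp add: rem_0 flow_demand_def)
next
  case (Suc n)
  show ?case
  proof (cases "finished n")
    case True
    then show ?thesis using Suc run_finished by simp
  next
    case False
    have "Min (events n) \<le> rem n f" if "f \<in> active n"
      using finite_events[OF False] that by (intro Min_le) (auto simp: events_def)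
    then show ?thesis using Suc by (simp add: rem_step[OF False])
  qed
qed

text \<open>Among the coflows with incomplete flows, one that is minimal in the precedence order is ready
  once all coflows have been released.\<close>

lemma events_nonempty:
  assumes nf: "\<not> finished n"
  shows "events n \<noteq> {}"
proof (cases "\<exists>k\<in>coflows I. release I k > tm n")
  case True
  then show ?thesis by (auto simp: events_def)
next
  case False
  then have rel: "\<And>k. k \<in> coflows I \<Longrightarrow> release I k \<le> tm n" by force
  let ?X = "{k \<in> coflows I. \<exists>f\<in>flows_of I k. rem n f \<noteq> 0}"
  have "finite (prec I)" using valid
    by (auto simp: valid_instance_def intro: finite_subset[of _ "coflows I \<times> coflows I"])
  then have wf: "wf ((prec I)\<^sup>+)" using valid by (auto simp: valid_instance_def intro: wf_trancl finite_acyclic_wf)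
  obtain f0 where f0: "f0 \<in> flows I" "rem n f0 \<noteq> 0" using nf by (auto simp: finished_def)
  then have "coflow_of f0 \<in> coflows I" "f0 \<in> flows_of I (coflow_of f0)"
    using coflow_of_flows[of f0] by (simp_all add: flows_of_def)
  then have "coflow_of f0 \<in> ?X" using f0(2) by blast
  from wf[unfolded wf_eq_minimal, rule_format, OF this]
  obtain k where k: "k \<in> ?X" and min: "\<forall>k'. (k', k) \<in> (prec I)\<^sup>+ \<longrightarrow> k' \<notin> ?X"
    by (rule bexE)
  have done_anc: "\<forall>f\<in>flows_of I k'. rem n f = 0" if "(k', k) \<in> (prec I)\<^sup>+" for k'
    using min[rule_format, OF that] that trancl_prec_subset[OF valid] by blast
  have "coflow_ready I (tm n) (rem n) k"
    unfolding coflow_ready_def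
  proof (intro allI impI)
    fix k' assume p: "(k', k) \<in> prec I"
    have anc: "(k'', k) \<in> (prec I)\<^sup>+" if "(k'', k') \<in> (prec I)\<^sup>*" for k''
      using that p by (rule rtrancl_into_trancl1)
    then have "k'' \<in> coflows I" if "(k'', k') \<in> (prec I)\<^sup>*" for k''
      using that trancl_prec_subset[OF valid] by blast
    then have "\<forall>k''. (k'', k') \<in> (prec I)\<^sup>* \<longrightarrow> release I k'' \<le> tm n \<and> (\<forall>f\<in>flows_of I k''. rem n f = 0)"
      using rel done_anc anc by blast
    moreover have "\<forall>f\<in>flows_of I k'. rem n f = 0" by (rule done_anc[OF anc[OF rtrancl_refl]])
    ultimately show "coflow_done I (tm n) (rem n) k'" unfolding coflow_done_def by argo
  qed
  moreover obtain f where f: "f \<in> flows_of I k" "rem n f \<noteq> 0" using k by blast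
  moreover have "0 < rem n f" using rem_nonneg[of f n] f by (auto simp: flows_of_def)
  moreover obtain h where h: "h \<in> core_set I" "k \<in> A h" using assigned k by blast
  ultimately have "f \<in> available I (A h) (tm n) (rem n)"
    using rel k by (auto simp: available_def flows_of_def)
  from scheduled_blocked[OF scheduled_step[OF nf] h(1) this] have "F n h \<noteq> {}" by blast
  then show ?thesis using h by (auto simp: events_def active_def)
qed

lemma Min_events_in: "\<not> finished n \<Longrightarrow> Min (events n) \<in> events n"
  by (intro Min_in finite_events events_nonempty)

lemma Min_events_pos: "\<not> finished n \<Longrightarrow> 0 < Min (events n)"
  using Min_events_in[of n] active_flow[of n] by (auto simp: events_def)

lemma tm_Suc_le: "tm n \<le> tm (Suc n)"
  using run_finished[of n] tm_step[of n] Min_events_pos[of n] by (cases "finished n") auto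

lemma tm_mono: "m \<le> n \<Longrightarrow> tm m \<le> tm n"
  by (rule lift_Suc_mono_le[of tm, OF tm_Suc_le])

lemma tm_nonneg: "0 \<le> tm n"
  using tm_mono[of 0 n] by (simp add: tm_0)

lemma rem_Suc_le: "rem (Suc n) f \<le> rem n f"
  using run_finished[of n] rem_step[of n] Min_events_pos[of n] by (cases "finished n") auto

lemma rem_antimono: "m \<le> n \<Longrightarrow> rem n f \<le> rem m f"
  by (rule lift_Suc_antimono_le[of "\<lambda>n. rem n f", OF rem_Suc_le])

lemma rem_stays_0: "f \<in> flows I \<Longrightarrow> rem m f = 0 \<Longrightarrow> m \<le> n \<Longrightarrow> rem n f = 0"
  using rem_antimono[of m n f] rem_nonneg[of f n] by simp

lemma finished_mono: "finished m \<Longrightarrow> m \<le> n \<Longrightarrow> finished n"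
  unfolding finished_def using rem_stays_0 by blast

text \<open>A pending release is itself an event, so no step jumps over it. This keeps the time
  spent waiting for releases below \<open>T0\<close> in \<open>flow_finishes\<close>.\<close>

lemma tm_Suc_le_release:
  assumes "k \<in> coflows I" "tm n < release I k"
  shows "tm (Suc n) \<le> release I k"
proof (cases "finished n")
  case False
  have "Min (events n) \<le> release I k - tm n"
    using assms finite_events[OF False] by (intro Min_le) (auto simp: events_def)
  then show ?thesis by (simp add: tm_step[OF False])
qed (use assms run_finished in auto)

text \<open>Every event completes a flow or releases a coflow.\<close>

lemma finished_exists: "\<exists>N. finished N"
proof (rule ccontr)
  assume nf: "\<nexists>N. finished N"
  define R where "R n = {f \<in> flows I. rem n f \<noteq> 0}" for n
  define U where "U n = {k \<in> coflows I. tm n < release I k}" for n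
  have fin: "finite (R n)" "finite (U n)" for n
    using finite_flows[OF valid] valid by (auto simp: R_def U_def valid_instance_def)
  define M where "M n = card (R n) + card (U n)" for n
  have dec: "M (Suc n) < M n" for n
  proof -
    have nfn: "\<not> finished n" using nf by blast
    have sub: "R (Suc n) \<subseteq> R n" "U (Suc n) \<subseteq> U n"
      using rem_stays_0[of _ n "Suc n"] tm_Suc_le[of n] by (auto simp: R_def U_def)
    have "R (Suc n) \<noteq> R n \<or> U (Suc n) \<noteq> U n"
    proof -
      consider f where "f \<in> active n" "Min (events n) = rem n f"
        | k where "k \<in> coflows I" "tm n < release I k" "Min (events n) = release I k - tm n"
        using Min_events_in[OF nfn] by (auto simp: events_def)
      then show ?thesis
      proof cases
        case 1
        then have "f \<in> R n" "f \<notin> R (Suc n)"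
          using active_flow[OF nfn 1(1)] rem_step[OF nfn] by (auto simp: R_def)
        then show ?thesis by blast
      next
        case 2
        then have "k \<in> U n" "k \<notin> U (Suc n)" using tm_step[OF nfn] by (auto simp: U_def)
        then show ?thesis by blast
      qed
    qed
    then consider "R (Suc n) \<subset> R n" | "U (Suc n) \<subset> U n" using sub by blast
    then show ?thesis
    proof cases
      case 1
      then show ?thesis using psubset_card_mono[OF fin(1) 1] card_mono[OF fin(2) sub(2)] by (simp add: M_def)
    next
      case 2
      then show ?thesis using psubset_card_mono[OF fin(2) 2] card_mono[OF fin(1) sub(1)] by (simp add: M_def)
    qed
  qed
  have "M n + n \<le> M 0" for n
  proof (induction n)
    case (Suc n)
    then show ?case using dec[of n] by linarith
  qed simp
  from this[of "Suc (M 0)"] show False by simp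
qed

definition horizon :: nat where
  "horizon = (LEAST N. finished N)"

lemma finished_horizon: "finished horizon"
  unfolding horizon_def using finished_exists by (rule LeastI_ex)

lemma finished_iff: "finished n \<longleftrightarrow> horizon \<le> n"
proof
  show "horizon \<le> n" if "finished n" unfolding horizon_def using that by (rule Least_le)
qed (rule finished_mono[OF finished_horizon])

section \<open>The run as a feasible continuous-time schedule\<close>

abbreviation x :: "'k schedule" where
  "x \<equiv> run_schedule tm F"

lemma run_interval_unique:
  assumes "tm n \<le> t" "t < tm (Suc n)" "tm n' \<le> t" "t < tm (Suc n')"
  shows "n = n'"
proof -
  have "\<not> n < n'" using tm_mono[of "Suc n" n'] assms by force
  moreover have "\<not> n' < n" using tm_mono[of "Suc n'" n] assms by force
  ultimately show ?thesis by simp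
qed

lemma x_cases:
  obtains "x h f t = 0"
  | n where "x h f t = 1" "tm n \<le> t" "t < tm (Suc n)" "f \<in> F n h" "\<not> finished n"
proof (cases "\<exists>n. tm n \<le> t \<and> t < tm (Suc n) \<and> f \<in> F n h")
  case True
  then obtain n where n: "tm n \<le> t" "t < tm (Suc n)" "f \<in> F n h" by blast
  \<comment> \<open>After the finish time stands still, so the interval of a finished step is
    empty.\<close>
  have "\<not> finished n" using run_finished(1)[of n] n by auto
  moreover have "x h f t = 1" using True by (simp add: run_schedule_def)
  ultimately show ?thesis using n that(2) by blast
next
  case False
  then have "x h f t = 0" by (simp add: run_schedule_def)
  then show ?thesis by (rule that(1))
qed

text \<open>The rate becomes a finite sum of indicator functions that can be integrated term by
  term. Steps from \<open>horizon\<close> on have empty intervals.\<close>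

lemma x_eq_sum:
  "x h f t = (\<Sum>n<horizon. if f \<in> F n h then (if t \<in> {tm n..<tm (Suc n)} then 1 else 0) else 0)"
proof (cases rule: x_cases[of h f t])
  case 1
  then have "\<not> (f \<in> F n h \<and> t \<in> {tm n..<tm (Suc n)})" for n
    by (auto simp: run_schedule_def split: if_splits)
  then have "(\<Sum>n<horizon. if f \<in> F n h then (if t \<in> {tm n..<tm (Suc n)} then 1 else 0) else (0::real)) = 0"
    by (intro sum.neutral) auto
  then show ?thesis using 1 by simp
next
  case (2 n0)
  have "(\<Sum>n<horizon. if f \<in> F n h then (if t \<in> {tm n..<tm (Suc n)} then 1 else 0) else 0)
      = (\<Sum>n<horizon. if n = n0 then 1 else (0::real))"
  proof (rule sum.cong)
    fix n
    have "t \<in> {tm n..<tm (Suc n)} \<longleftrightarrow> n = n0"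
      using run_interval_unique[of n t n0] 2 by fastforce
    then show "(if f \<in> F n h then (if t \<in> {tm n..<tm (Suc n)} then 1 else 0) else 0) = (if n = n0 then 1 else (0::real))"
      using 2(4) by auto
  qed simp
  also have "\<dots> = 1" using 2(5) by (simp add: finished_iff)
  finally show ?thesis using 2 by simp
qed

lemma has_integral_window:
  fixes a b T :: real
  assumes "0 \<le> a" "a \<le> b" "0 \<le> T"
  shows "((\<lambda>t. if t \<in> {a..<b} then 1 else 0) has_integral min T b - min T a) {0..T}"
\<comment> \<open>On \<open>{0..T}\<close> the half-open window and the closed interval between the
  two minima differ at most in the point \<open>min T b\<close>.\<close>
proof (rule has_integral_spike_finite[where S = "{min T b}"])
  have "((\<lambda>t. 1) has_integral min T b - min T a) {min T a..min T b}"
    using has_integral_const_real[of "1::real" "min T a" "min T b"] min.coboundedI2[OF assms(2), of T] by simp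
  then show "((\<lambda>t. if t \<in> {min T a..min T b} then 1 else 0) has_integral min T b - min T a) {0..T}"
    using assms by (subst has_integral_restrict) auto
qed (auto simp: min_def split: if_splits)

lemma has_integral_x:
  assumes "0 \<le> T"
  shows "(x h f has_integral
    (\<Sum>n<horizon. if f \<in> F n h then min T (tm (Suc n)) - min T (tm n) else 0)) {0..T}"
proof -
  have "((\<lambda>t. \<Sum>n<horizon. if f \<in> F n h then (if t \<in> {tm n..<tm (Suc n)} then 1 else 0) else 0)
    has_integral (\<Sum>n<horizon. if f \<in> F n h then min T (tm (Suc n)) - min T (tm n) else 0)) {0..T}"
  proof (rule has_integral_sum)
    fix n
    show "((\<lambda>t. if f \<in> F n h then (if t \<in> {tm n..<tm (Suc n)} then 1 else 0) else 0)
      has_integral (if f \<in> F n h then min T (tm (Suc n)) - min T (tm n) else 0)) {0..T}"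
      using has_integral_window[OF tm_nonneg[of n] tm_Suc_le[of n] assms] by auto
  qed simp
  moreover have "x h f = (\<lambda>t. \<Sum>n<horizon. if f \<in> F n h then (if t \<in> {tm n..<tm (Suc n)} then 1 else 0) else 0)"
    by (rule ext) (rule x_eq_sum)
  ultimately show ?thesis by simp
qed

lemma transmitting_core_unique:
  "\<not> finished n \<Longrightarrow> h \<in> core_set I \<Longrightarrow> h' \<in> core_set I \<Longrightarrow> f \<in> F n h \<Longrightarrow> f \<in> F n h' \<Longrightarrow> h = h'"
  using transmitted_available[of n h f] transmitted_available[of n h' f] assigned_unique
  by (auto simp: available_def)

text \<open>Uniqueness of the core transmitting an active flow collapses the sum over the cores to a
  single term.\<close>

lemma sent_eq:
  assumes "0 \<le> T"
  shows "sent I x f T = (\<Sum>n<horizon. if f \<in> active n then min T (tm (Suc n)) - min T (tm n) else 0)"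
proof -
  have "sent I x f T
    = (\<Sum>h\<in>core_set I. \<Sum>n<horizon. if f \<in> F n h then min T (tm (Suc n)) - min T (tm n) else 0)"
    unfolding sent_def by (rule sum.cong) (simp_all add: integral_unique[OF has_integral_x[OF assms]])
  also have "\<dots> = (\<Sum>n<horizon. \<Sum>h\<in>core_set I. if f \<in> F n h then min T (tm (Suc n)) - min T (tm n) else 0)"
    by (rule sum.swap)
  also have "\<dots> = (\<Sum>n<horizon. if f \<in> active n then min T (tm (Suc n)) - min T (tm n) else 0)"
  proof (rule sum.cong)
    fix n assume "n \<in> {..<horizon}"
    then have nf: "\<not> finished n" by (simp add: finished_iff)
    show "(\<Sum>h\<in>core_set I. if f \<in> F n h then min T (tm (Suc n)) - min T (tm n) else 0)
      = (if f \<in> active n then min T (tm (Suc n)) - min T (tm n) else 0)"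
    proof (cases "f \<in> active n")
      case True
      then obtain h0 where h0: "h0 \<in> core_set I" "f \<in> F n h0" by (auto simp: active_def)
      have "(\<Sum>h\<in>core_set I. if f \<in> F n h then min T (tm (Suc n)) - min T (tm n) else 0)
        = (\<Sum>h\<in>core_set I. if h = h0 then min T (tm (Suc n)) - min T (tm n) else 0)"
      proof (rule sum.cong)
        fix h assume h: "h \<in> core_set I"
        have "f \<in> F n h \<longleftrightarrow> h = h0"
          using transmitting_core_unique[OF nf h h0(1) _ h0(2)] h0(2) by blast
        then show "(if f \<in> F n h then min T (tm (Suc n)) - min T (tm n) else 0)
          = (if h = h0 then min T (tm (Suc n)) - min T (tm n) else 0)" by simp
      qed simp
      then show ?thesis using True h0(1) by simp
    next
      case False
      then show ?thesis by (auto simp: active_def intro!: sum.neutral)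
    qed
  qed simp
  finally show ?thesis .
qed

lemma demand_minus_rem:
  "(\<Sum>n<m. if f \<in> active n then tm (Suc n) - tm n else 0) = flow_demand I f - rem m f"
proof (induction m)
  case 0
  then show ?case by (simp add: rem_0)
next
  case (Suc m)
  then show ?case
    by (cases "finished m") (simp_all add: run_finished rem_step tm_step)
qed

lemma sent_tm:
  assumes "m \<le> horizon"
  shows "sent I x f (tm m) = flow_demand I f - rem m f"
proof -
  have "sent I x f (tm m)
    = (\<Sum>n<m. if f \<in> active n then min (tm m) (tm (Suc n)) - min (tm m) (tm n) else 0)"
    \<comment> \<open>From index \<open>m\<close> on both minima equal \<open>tm m\<close> and the
      terms vanish.\<close>
    unfolding sent_eq[OF tm_nonneg]
    by (rule sum.mono_neutral_right) (use assms tm_mono in \<open>auto simp: min_absorb1\<close>)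
  also have "\<dots> = (\<Sum>n<m. if f \<in> active n then tm (Suc n) - tm n else 0)"
    by (rule sum.cong) (use tm_mono in \<open>auto simp: min_absorb2\<close>)
  finally show ?thesis by (simp add: demand_minus_rem)
qed

lemma sent_le_demand:
  assumes f: "f \<in> flows I" and T: "0 \<le> T"
  shows "sent I x f T \<le> flow_demand I f"
proof -
  have "sent I x f T \<le> (\<Sum>n<horizon. if f \<in> active n then tm (Suc n) - tm n else 0)"
    unfolding sent_eq[OF T]
  proof (rule sum_mono)
    fix n
    show "(if f \<in> active n then min T (tm (Suc n)) - min T (tm n) else 0)
      \<le> (if f \<in> active n then tm (Suc n) - tm n else 0)"
      using tm_Suc_le[of n] by (auto simp: min_def)
  qed
  also have "\<dots> \<le> flow_demand I f"
    using rem_nonneg[OF f] by (simp add: demand_minus_rem)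
  finally show ?thesis .
qed

lemma flow_completion_le_tm:
  assumes f: "f \<in> flows I" and r: "rem m f = 0"
  shows "flow_completion I x f \<le> tm m"
proof -
  \<comment> \<open>\<open>sent_tm\<close> covers indices up to \<open>horizon\<close> only. If
    \<open>m\<close> lies beyond it, the flow is already complete at \<open>horizon\<close>.\<close>
  let ?m = "min m horizon"
  have "rem ?m f = 0" using r finished_horizon f by (auto simp: finished_def min_def)
  then have "sent I x f (tm ?m) = flow_demand I f" by (simp add: sent_tm)
  then have "flow_completion I x f \<le> tm ?m"
    unfolding flow_completion_def by (intro cInf_lower bdd_belowI[of _ 0]) (auto simp: tm_nonneg)
  also have "\<dots> \<le> tm m" by (rule tm_mono) simp
  finally show ?thesis .
qed

text \<open>Links the discrete test used by the algorithm with the completion time defined through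
  integrals. The precedence condition of feasibility rests on it: whatever is ready at an event
  starts no earlier than its predecessors complete.\<close>

lemma coflow_completion_le_tm:
  assumes "coflow_done I (tm n) (rem n) k"
  shows "coflow_completion I x k \<le> tm n"
proof (rule coflow_completion_le[OF valid])
  fix k' f assume k': "(k', k) \<in> (prec I)\<^sup>*" and f: "f \<in> flows_of I k'" and "flows_of I k = {} \<or> k' = k"
  then have "rem n f = 0" using assms by (auto simp: coflow_done_def split: if_splits)
  then show "flow_completion I x f \<le> tm n"
    using f by (intro flow_completion_le_tm) (auto simp: flows_of_def)
next
  fix k' assume "(k', k) \<in> (prec I)\<^sup>*" "flows_of I k = {}"
  then show "release I k' \<le> tm n" using assms by (auto simp: coflow_done_def)
qed

text \<open>Rates are 0 or 1, and the flows a core transmits within one interval form a matching, so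
  at most one term of the sum is nonzero.\<close>

lemma x_port_capacity:
  assumes p: "p \<in> sides" and h: "h \<in> core_set I"
  shows "(\<Sum>f | f \<in> flows I \<and> p f = i. x h f t) \<le> 1"
proof (cases "\<exists>f0. f0 \<in> flows I \<and> p f0 = i \<and> x h f0 t \<noteq> 0")
  case True
  then obtain f0 where f0: "f0 \<in> flows I" "p f0 = i" "x h f0 t \<noteq> 0" by blast
  have "x h f t = (if f = f0 then 1 else 0)" if f: "f \<in> flows I" "p f = i" for f
  proof (cases rule: x_cases[of h f t])
    case 1
    then show ?thesis using f0 by auto
  next
    case n: (2 n)
    show ?thesis
    proof (cases rule: x_cases[of h f0 t])
      case 1
      then show ?thesis using f0 by simp
    next
      case n0: (2 n0)
      have "n = n0" using run_interval_unique n n0 by blast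
      then have "f \<in> F n h" "f0 \<in> F n h" using n n0 by auto
      moreover have "inj_on p (F n h)"
        using scheduled_port_disjoint[OF scheduled_step[OF n(5)] h] p by (simp add: port_disjoint_def)
      ultimately have "f = f0" using f f0 by (auto dest: inj_onD)
      then show ?thesis using n by simp
    qed
  qed
  then have "(\<Sum>f | f \<in> flows I \<and> p f = i. x h f t) = (\<Sum>f | f \<in> flows I \<and> p f = i. if f = f0 then 1 else 0)"
    by (intro sum.cong) auto
  also have "\<dots> \<le> 1" using f0 finite_flows[OF valid] by simp
  finally show ?thesis .
next
  case False
  then have "(\<Sum>f | f \<in> flows I \<and> p f = i. x h f t) = 0" by (intro sum.neutral) auto
  then show ?thesis by simp
qed

lemma x_available:
  assumes "h \<in> core_set I" "x h f t \<noteq> 0"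
  obtains n where "tm n \<le> t" "f \<in> available I (A h) (tm n) (rem n)"
  using assms transmitted_available that by (cases rule: x_cases[of h f t]) blast+

lemma feasible_x: "feasible I x"
proof -
  have int: "x h f integrable_on {0..T}" if "0 \<le> T" for h f T
    using has_integral_x[OF that] by (rule has_integral_integrable)
  have nn: "0 \<le> x h f t" for h f t by (simp add: run_schedule_def)
  have ports: "(\<Sum>f | f \<in> flows I \<and> input_of f = i. x h f t) \<le> 1"
    "(\<Sum>f | f \<in> flows I \<and> output_of f = i. x h f t) \<le> 1" if "h \<in> core_set I" for h i t
    using x_port_capacity[OF _ that] by (auto simp: sides_def)
  have fin: "\<exists>T\<ge>0. sent I x f T = flow_demand I f" if "f \<in> flows I" for f
    using finished_horizon that tm_nonneg
    by (intro exI[of _ "tm horizon"]) (simp add: sent_tm finished_def)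
  have rel: "x h f t = 0" if "h \<in> core_set I" "t < release I (coflow_of f)" for h f t
  proof (rule ccontr)
    assume "x h f t \<noteq> 0"
    with that(1) obtain n where "tm n \<le> t" "f \<in> available I (A h) (tm n) (rem n)" by (rule x_available)
    then show False using that by (auto simp: available_def)
  qed
  have pre: "x h f t = 0"
    if "(k', k) \<in> prec I" "h \<in> core_set I" "f \<in> flows_of I k" "t < coflow_completion I x k'" for k k' h f t
  proof (rule ccontr)
    assume "x h f t \<noteq> 0"
    with that(2) obtain n where n: "tm n \<le> t" "f \<in> available I (A h) (tm n) (rem n)" by (rule x_available)
    then have "coflow_done I (tm n) (rem n) k'"
      using that by (auto simp: available_def coflow_ready_def flows_of_def)
    from coflow_completion_le_tm[OF this] show False using n that by simp
  qed
  show ?thesis unfolding feasible_def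
    using int nn ports fin rel pre sent_le_demand by (intro conjI ballI allI impI) auto
qed

lemma indivisible_x: "indivisible I x"
  unfolding indivisible_def
proof
  fix k assume "k \<in> coflows I"
  then obtain h where h: "h \<in> core_set I" "k \<in> A h" using assigned by blast
  have "x h' f t = 0" if "h' \<in> core_set I" "h' \<noteq> h" "f \<in> flows_of I k" for h' f t
  proof (rule ccontr)
    assume "x h' f t \<noteq> 0"
    with that(1) obtain n where "f \<in> available I (A h') (tm n) (rem n)" by (rule x_available)
    then have "k \<in> A h'" using that by (auto simp: available_def flows_of_def)
    then show False using assigned_unique h that by blast
  qed
  then show "\<exists>h\<in>core_set I. \<forall>h'\<in>core_set I. h' \<noteq> h \<longrightarrow> (\<forall>f\<in>flows_of I k. \<forall>t\<ge>0. x h' f t = 0)"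
    using h(1) by blast
qed

end

section \<open>Depth in the precedence graph\<close>

definition coflow_path :: "'k coflow_instance \<Rightarrow> 'k list \<Rightarrow> bool" where
  "coflow_path I p \<longleftrightarrow>
     distinct p \<and> set p \<subseteq> coflows I \<and> successively (\<lambda>a b. (a, b) \<in> prec I) p"

text \<open>Coflows are counted rather than edges, so a coflow without predecessors has depth 1 and
  receives one full share of \<open>4 m + 1\<close>.\<close>

definition depth :: "'k coflow_instance \<Rightarrow> 'k \<Rightarrow> nat" where
  "depth I k = Max {length p | p. coflow_path I p \<and> p \<noteq> [] \<and> last p = k}"

lemma finite_path_lengths:
  assumes "valid_instance I"
  shows "finite {length p | p. coflow_path I p \<and> P p}"
proof -
  have fin: "finite (coflows I)" using assms by (simp add: valid_instance_def)
  have "{length p | p. coflow_path I p \<and> P p} \<subseteq> {..card (coflows I)}"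
    using card_mono[OF fin] by (auto simp: coflow_path_def simp flip: distinct_card)
  then show ?thesis by (rule finite_subset) simp
qed

lemma coflow_path_singleton: "k \<in> coflows I \<Longrightarrow> coflow_path I [k]"
  by (simp add: coflow_path_def)

lemma depth_pos:
  assumes "valid_instance I" "k \<in> coflows I"
  shows "1 \<le> depth I k"
proof -
  have "length [k] \<in> {length p | p. coflow_path I p \<and> p \<noteq> [] \<and> last p = k}"
    using coflow_path_singleton[OF assms(2)] by fastforce
  from Max_ge[OF finite_path_lengths[OF assms(1)] this] show ?thesis by (simp add: depth_def)
qed

lemma depth_attained:
  assumes "valid_instance I" "k \<in> coflows I"
  shows "\<exists>p. coflow_path I p \<and> p \<noteq> [] \<and> last p = k \<and> length p = depth I k"
proof -
  let ?S = "{length p | p. coflow_path I p \<and> p \<noteq> [] \<and> last p = k}"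
  have "length [k] \<in> ?S" using coflow_path_singleton[OF assms(2)] by fastforce
  then have "?S \<noteq> {}" by blast
  from Max_in[OF finite_path_lengths[OF assms(1)] this] show ?thesis unfolding depth_def by force
qed

lemma depth_le_max_path:
  assumes "valid_instance I" "k \<in> coflows I"
  shows "depth I k \<le> max_path_coflows I"
proof -
  have eq: "max_path_coflows I = Max {length p | p. coflow_path I p \<and> True}"
    by (simp add: max_path_coflows_def coflow_path_def)
  obtain p where "coflow_path I p" "length p = depth I k" using depth_attained[OF assms] by blast
  then have "depth I k \<in> {length p | p. coflow_path I p \<and> True}" by force
  then show ?thesis unfolding eq by (intro Max_ge finite_path_lengths[OF assms(1)])
qed

lemma successively_rtrancl_last:
  "successively (\<lambda>a b. (a, b) \<in> R) p \<Longrightarrow> k \<in> set p \<Longrightarrow> (k, last p) \<in> R\<^sup>*"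
proof (induction p arbitrary: k rule: induct_list012)
  case (3 a b p)
  then have b: "(b, last (b # p)) \<in> R\<^sup>*" and ab: "(a, b) \<in> R"
    using "3.IH"(2)[of b] by simp_all
  show ?case
  proof (cases "k = a")
    case True
    then show ?thesis using converse_rtrancl_into_rtrancl[OF ab b] by simp
  next
    case False
    then show ?thesis using 3 by simp
  qed
qed auto

text \<open>A longest path ending in \<open>k'\<close> is extended by \<open>k\<close>; acyclicity
  ensures that \<open>k\<close> is not already on it.\<close>

lemma depth_prec:
  assumes v: "valid_instance I" and p: "(k', k) \<in> prec I"
  shows "depth I k' + 1 \<le> depth I k"
proof -
  have k: "k' \<in> coflows I" "k \<in> coflows I" using v p by (auto simp: valid_instance_def)
  obtain q where q: "coflow_path I q" "q \<noteq> []" "last q = k'" "length q = depth I k'"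
    using depth_attained[OF v k(1)] by blast
  have "k \<notin> set q"
  proof
    assume "k \<in> set q"
    then have "(k, k') \<in> (prec I)\<^sup>*"
      using successively_rtrancl_last[of "prec I" q k] q by (simp add: coflow_path_def)
    then have "(k, k) \<in> (prec I)\<^sup>+" using p by (rule rtrancl_into_trancl1)
    then show False using v by (simp add: valid_instance_def acyclic_def)
  qed
  then have "coflow_path I (q @ [k])"
    using q k p by (auto simp: coflow_path_def successively_append_iff)
  then have "length (q @ [k]) \<le> depth I k"
    unfolding depth_def by (intro Max_ge finite_path_lengths[OF v]) force
  then show ?thesis using q by simp
qed

lemma depth_trancl:
  assumes "valid_instance I" "(k', k) \<in> (prec I)\<^sup>+"
  shows "depth I k' + 1 \<le> depth I k"
  using assms(2) by (induction rule: trancl_induct) (use depth_prec[OF assms(1)] in fastforce)+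

section \<open>The approximation ratio\<close>

lemma port_load_exists:
  assumes "p \<in> sides" "i \<in> port_set I"
  shows "\<exists>L\<in>port_loads I. \<forall>k\<in>coflows I. L k = (\<Sum>f | f \<in> flows_of I k \<and> p f = i. flow_demand I f)"
proof -
  consider "p = (\<lambda>f. input_of f)" | "p = (\<lambda>f. output_of f)" using assms by (auto simp: sides_def)
  then show ?thesis
  proof cases
    case 1
    then show ?thesis using assms by (intro bexI[of _ "in_load I i"]) (simp_all add: port_loads_def in_load_eq)
  next
    case 2
    then show ?thesis using assms by (intro bexI[of _ "out_load I i"]) (simp_all add: port_loads_def out_load_eq)
  qed
qed

context transmission
begin

text \<open>The sum ranges over all cores and includes ties and \<open>f\<close> itself. Its initial
  value is therefore a full prefix load of the port, the quantity that the LP controls.\<close>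

definition backlog :: "('k flow \<Rightarrow> nat) \<Rightarrow> 'k flow \<Rightarrow> nat \<Rightarrow> real" where
  "backlog p f n = (\<Sum>g | g \<in> flows I \<and> p g = p f \<and> C (coflow_of g) \<le> C (coflow_of f). rem n g)"

lemma backlog_nonneg: "0 \<le> backlog p f n"
  unfolding backlog_def by (rule sum_nonneg) (auto intro: rem_nonneg)

lemma backlog_Suc_le: "backlog p f (Suc n) \<le> backlog p f n"
  unfolding backlog_def by (rule sum_mono) (rule rem_Suc_le)

lemma backlog_antimono: "backlog p f n \<le> backlog p f 0"
  by (induction n) (auto intro: order_trans[OF backlog_Suc_le])

text \<open>One counted flow transmitted at rate 1 already drains the whole duration of the step,
  while the other terms do not grow.\<close>

lemma backlog_decreases:
  assumes nf: "\<not> finished n" and g: "g \<in> active n" "p g = p f" "C (coflow_of g) \<le> C (coflow_of f)"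
  shows "backlog p f (Suc n) \<le> backlog p f n - (tm (Suc n) - tm n)"
proof -
  let ?G = "{g. g \<in> flows I \<and> p g = p f \<and> C (coflow_of g) \<le> C (coflow_of f)}"
  have fin: "finite ?G" by (rule finite_subset[OF _ finite_flows[OF valid]]) auto
  have gG: "g \<in> ?G" using active_flow[OF nf g(1)] g by simp
  have "(\<Sum>g'\<in>?G - {g}. rem (Suc n) g') \<le> (\<Sum>g'\<in>?G - {g}. rem n g')"
    by (rule sum_mono) (rule rem_Suc_le)
  moreover have "rem (Suc n) g = rem n g - (tm (Suc n) - tm n)"
    using g(1) by (simp add: rem_step[OF nf] tm_step[OF nf])
  ultimately show ?thesis
    unfolding backlog_def sum.remove[OF fin gG] by linarith
qed

lemma backlog_0_le:
  assumes C: "lp_feasible I C" and p: "p \<in> sides" and f: "f \<in> flows I"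
  shows "backlog p f 0 \<le> 2 * real (cores I) * C (coflow_of f)"
proof -
  let ?S = "{l. l \<in> coflows I \<and> C l \<le> C (coflow_of f)}"
  have "p f \<in> port_set I" using p flows_port[OF f] by (auto simp: sides_def)
  then obtain L where L: "L \<in> port_loads I"
    and Lk: "\<forall>k\<in>coflows I. L k = (\<Sum>g | g \<in> flows_of I k \<and> p g = p f. flow_demand I g)"
    using port_load_exists[OF p] by blast
  have "backlog p f 0 = (\<Sum>g | g \<in> flows I \<and> coflow_of g \<in> ?S \<and> p g = p f. flow_demand I g)"
    unfolding backlog_def rem_0 by (rule sum.cong) (use coflow_of_flows in blast)+
  also have "\<dots> = (\<Sum>l\<in>?S. \<Sum>g | g \<in> flows_of I l \<and> p g = p f. flow_demand I g)"
    by (rule sum_flows_by_coflow[OF valid, symmetric]) auto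
  also have "\<dots> = (\<Sum>l\<in>?S. L l)" using Lk by (intro sum.cong) auto
  also have "\<dots> \<le> 2 * real (cores I) * C (coflow_of f)"
    by (rule lp_feasible_prefix_load[OF valid C L coflow_of_flows[OF f]])
  finally show ?thesis .
qed

text \<open>From the time \<open>T0\<close> on, \<open>f\<close> is available until it completes, so at each moment its input or its
  output port on its core transmits a flow that is listed no later.  Hence the current time plus
  the backlogs of the two ports cannot increase.\<close>

lemma flow_finishes:
  assumes C: "lp_feasible I C" and f: "f \<in> flows I" and T0: "0 \<le> T0"
    and rel: "\<And>k'. (k', coflow_of f) \<in> (prec I)\<^sup>* \<Longrightarrow> release I k' \<le> T0"
    and anc: "\<And>k' g. (k', coflow_of f) \<in> (prec I)\<^sup>+ \<Longrightarrow> g \<in> flows_of I k' \<Longrightarrow> \<exists>n. rem n g = 0 \<and> tm n \<le> T0"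
  shows "\<exists>n. rem n f = 0 \<and> tm n \<le> T0 + 4 * real (cores I) * C (coflow_of f)"
proof -
  let ?k = "coflow_of f"
  define \<Phi> where "\<Phi> n = backlog (\<lambda>f. input_of f) f n + backlog (\<lambda>f. output_of f) f n" for n
  have k: "?k \<in> coflows I" by (rule coflow_of_flows[OF f])
  obtain h where h: "h \<in> core_set I" "?k \<in> A h" using assigned[OF k] by blast
  have unavail: "tm (Suc n) \<le> T0" if r: "0 < rem n f" and na: "f \<notin> available I (A h) (tm n) (rem n)" for n
  proof -
    have rel_case: "tm (Suc n) \<le> T0" if "(k', ?k) \<in> (prec I)\<^sup>*" "tm n < release I k'" for k'
      using tm_Suc_le_release[of k' n] rtrancl_prec_coflow[OF valid that(1) k] rel[OF that(1)] that(2) by linarith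
    have flow_case: "tm (Suc n) \<le> T0" if a: "(k', ?k) \<in> (prec I)\<^sup>+" and g: "g \<in> flows_of I k'" and ng: "rem n g \<noteq> 0" for k' g
    proof -
      obtain n1 where n1: "rem n1 g = 0" "tm n1 \<le> T0" using anc[OF a g] by blast
      have "g \<in> flows I" using g by (simp add: flows_of_def)
      then have "n < n1" using rem_stays_0[of g n1 n] n1(1) ng by (cases "n1 \<le> n") auto
      then show ?thesis using tm_mono[of "Suc n" n1] n1(2) by simp
    qed
    show ?thesis
    proof (cases "release I ?k \<le> tm n")
      case False
      then show ?thesis using rel_case[of ?k] by simp
    next
      case True
      then have "\<not> coflow_ready I (tm n) (rem n) ?k"
        using na r f h(2) by (simp add: available_def)
      then obtain k' where k': "(k', ?k) \<in> prec I" "\<not> coflow_done I (tm n) (rem n) k'"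
        by (auto simp: coflow_ready_def)
      \<comment> \<open>An ancestor \<open>k''\<close> of \<open>k'\<close> is needed here because
        an empty predecessor is done only when all its ancestors are released and complete.\<close>
      then consider k'' where "(k'', k') \<in> (prec I)\<^sup>*" "tm n < release I k''"
        | k'' g where "(k'', k') \<in> (prec I)\<^sup>*" "g \<in> flows_of I k''" "rem n g \<noteq> 0"
        unfolding coflow_done_def by (metis not_le rtrancl.rtrancl_refl)
      then show ?thesis
      proof cases
        case 1
        then show ?thesis using rel_case k'(1) by (meson rtrancl_into_rtrancl)
      next
        case 2
        then show ?thesis using flow_case k'(1) by (meson rtrancl_into_trancl1)
      qed
    qed
  qed
  have avail: "tm (Suc n) + \<Phi> (Suc n) \<le> tm n + \<Phi> n"
    if r: "0 < rem n f" and a: "f \<in> available I (A h) (tm n) (rem n)" for n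
  proof -
    have nf: "\<not> finished n" using r f unfolding finished_def by (metis less_irrefl)
    obtain g where g: "g \<in> F n h" "input_of g = input_of f \<or> output_of g = output_of f"
      "C (coflow_of g) \<le> C (coflow_of f)"
      using scheduled_blocked[OF scheduled_step[OF nf] h(1) a] by blast
    have "g \<in> active n" using g(1) h(1) by (auto simp: active_def)
    from g(2) show ?thesis
    proof
      assume "input_of g = input_of f"
      then show ?thesis
        using backlog_decreases[OF nf \<open>g \<in> active n\<close> _ g(3), of "\<lambda>f. input_of f"]
          backlog_Suc_le[of "\<lambda>f. output_of f" f n] unfolding \<Phi>_def by linarith
    next
      assume "output_of g = output_of f"
      then show ?thesis
        using backlog_decreases[OF nf \<open>g \<in> active n\<close> _ g(3), of "\<lambda>f. output_of f"]
          backlog_Suc_le[of "\<lambda>f. input_of f" f n] unfolding \<Phi>_def by linarith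
    qed
  qed
  have \<Phi>0: "\<Phi> n \<le> \<Phi> 0" for n
    unfolding \<Phi>_def by (intro add_mono backlog_antimono)
  have inv: "tm n + \<Phi> n \<le> T0 + \<Phi> 0" if "\<forall>n'<n. 0 < rem n' f" for n
    using that
  proof (induction n)
    case 0
    then show ?case using T0 by (simp add: tm_0)
  next
    case (Suc n)
    then have r: "0 < rem n f" and IH: "tm n + \<Phi> n \<le> T0 + \<Phi> 0" by auto
    show ?case
    proof (cases "f \<in> available I (A h) (tm n) (rem n)")
      case True
      then show ?thesis using avail[OF r] IH by linarith
    next
      case False
      \<comment> \<open>The invariant is re-established from scratch: the step ends by
        \<open>T0\<close>, and the backlogs never exceed their initial values.\<close>
      then show ?thesis using unavail[OF r] \<Phi>0[of "Suc n"] by linarith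
    qed
  qed
  define N where "N = (LEAST n. rem n f = 0)"
  have "rem horizon f = 0" using finished_horizon f by (simp add: finished_def)
  then have N0: "rem N f = 0" unfolding N_def by (rule LeastI)
  have "\<forall>n'<N. 0 < rem n' f"
    using not_less_Least[of _ "\<lambda>n. rem n f = 0"] rem_nonneg[OF f] unfolding N_def
    by (metis less_eq_real_def)
  then have "tm N + \<Phi> N \<le> T0 + \<Phi> 0" by (rule inv)
  moreover have "0 \<le> \<Phi> N" unfolding \<Phi>_def by (intro add_nonneg_nonneg backlog_nonneg)
  moreover have "\<Phi> 0 \<le> 4 * real (cores I) * C ?k"
    using backlog_0_le[OF C _ f, of "\<lambda>f. input_of f"] backlog_0_le[OF C _ f, of "\<lambda>f. output_of f"]
    by (simp add: \<Phi>_def sides_def)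
  ultimately have "tm N \<le> T0 + 4 * real (cores I) * C ?k" by linarith
  then show ?thesis using N0 by blast
qed

section \<open>Completion bounds by induction on the depth\<close>

definition time_bound :: "'k \<Rightarrow> real" where
  "time_bound k = (4 * real (cores I) + 1) * real (depth I k) * C k"

text \<open>A proper ancestor has smaller depth and no larger LP value, so one share of
  \<open>4 m + 1\<close> remains free for the wait at \<open>k\<close> itself.\<close>

lemma time_bound_ancestor:
  assumes C: "lp_feasible I C" and a: "(k', k) \<in> (prec I)\<^sup>+"
  shows "time_bound k' \<le> (4 * real (cores I) + 1) * (real (depth I k) - 1) * C k"
proof -
  have k: "k' \<in> coflows I" "k \<in> coflows I" using a trancl_prec_subset[OF valid] by auto
  have "C k' \<le> C k" using lp_feasible_ancestor_le[OF valid C] a by (simp add: trancl_into_rtrancl)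
  moreover have "real (depth I k') \<le> real (depth I k) - 1" using depth_trancl[OF valid a] by linarith
  ultimately show ?thesis unfolding time_bound_def
    using lp_feasible_nonneg[OF valid C k(1)] by (intro mult_mono mult_nonneg_nonneg) auto
qed

lemma release_le_time_bound:
  assumes C: "lp_feasible I C" and k: "k \<in> coflows I"
  shows "release I k \<le> time_bound k"
proof -
  have "release I k \<le> 1 * 1 * C k" using lp_feasible_release_le[OF valid C k] by simp
  also have "\<dots> \<le> time_bound k" unfolding time_bound_def
    using depth_pos[OF valid k] lp_feasible_nonneg[OF valid C k] by (intro mult_mono) auto
  finally show ?thesis .
qed

lemma flow_time_bound:
  assumes C: "lp_feasible I C"
  shows "f \<in> flows_of I k \<Longrightarrow> \<exists>n. rem n f = 0 \<and> tm n \<le> time_bound k"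
proof (induction "depth I k" arbitrary: k f rule: less_induct)
  case less
  have f: "f \<in> flows I" "coflow_of f = k" using less.prems by (auto simp: flows_of_def)
  then have k: "k \<in> coflows I" using coflow_of_flows by blast
  let ?c = "4 * real (cores I) + 1"
  \<comment> \<open>The first term covers the releases of \<open>k\<close> and all its ancestors,
    the second the completion of every ancestor flow by the induction hypothesis.\<close>
  define T0 where "T0 = max (C k) (?c * (real (depth I k) - 1) * C k)"
  have Ck: "0 \<le> C k" by (rule lp_feasible_nonneg[OF valid C k])
  have d: "1 \<le> real (depth I k)" using depth_pos[OF valid k] by simp
  have "\<exists>n. rem n f = 0 \<and> tm n \<le> T0 + 4 * real (cores I) * C (coflow_of f)"
  proof (rule flow_finishes[OF C f(1)])
    show "0 \<le> T0" using Ck by (simp add: T0_def)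
  next
    fix k' assume a: "(k', coflow_of f) \<in> (prec I)\<^sup>*"
    then have a: "(k', k) \<in> (prec I)\<^sup>*" by (simp add: f)
    have "release I k' \<le> C k'" by (rule lp_feasible_release_le[OF valid C rtrancl_prec_coflow[OF valid a k]])
    also have "\<dots> \<le> C k" by (rule lp_feasible_ancestor_le[OF valid C a])
    finally show "release I k' \<le> T0" by (simp add: T0_def)
  next
    fix k' g assume a: "(k', coflow_of f) \<in> (prec I)\<^sup>+" and g: "g \<in> flows_of I k'"
    then have a: "(k', k) \<in> (prec I)\<^sup>+" by (simp add: f)
    have "depth I k' < depth I k" using depth_trancl[OF valid a] by simp
    then obtain n where "rem n g = 0" "tm n \<le> time_bound k'" using less.hyps[OF _ g] by blast
    moreover have "time_bound k' \<le> T0" using time_bound_ancestor[OF C a] by (simp add: T0_def)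
    ultimately show "\<exists>n. rem n g = 0 \<and> tm n \<le> T0" using order_trans by blast
  qed
  moreover have "T0 + 4 * real (cores I) * C k \<le> time_bound k"
  proof -
    \<comment> \<open>If \<open>C k\<close> is the maximum, depth at least 1 suffices; this is tight
      at depth 1.\<close>
    have "C k + 4 * real (cores I) * C k = ?c * 1 * C k" by (simp add: algebra_simps)
    also have "\<dots> \<le> time_bound k" unfolding time_bound_def
      using d Ck by (intro mult_right_mono mult_left_mono) auto
    finally have 1: "C k + 4 * real (cores I) * C k \<le> time_bound k" .
    have "?c * (real (depth I k) - 1) * C k + 4 * real (cores I) * C k \<le> time_bound k"
      using Ck by (simp add: time_bound_def algebra_simps)
    then show ?thesis using 1 by (simp add: T0_def max_def)
  qed
  ultimately show ?case by (auto simp: f)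
qed

text \<open>Monotonicity of \<open>time_bound\<close> along ancestors is what covers empty coflows,
  whose completion time involves the flows and releases of all ancestors.\<close>

lemma coflow_completion_bound:
  assumes C: "lp_feasible I C" and k: "k \<in> coflows I"
  shows "coflow_completion I x k \<le> time_bound k"
proof -
  have mono: "time_bound k' \<le> time_bound k" if "(k', k) \<in> (prec I)\<^sup>*" for k'
  proof (cases "k' = k")
    case False
    then have "(k', k) \<in> (prec I)\<^sup>+" using that by (simp add: rtrancl_eq_or_trancl)
    from time_bound_ancestor[OF C this]
    have "time_bound k' \<le> (4 * real (cores I) + 1) * (real (depth I k) - 1) * C k" .
    also have "\<dots> \<le> time_bound k" unfolding time_bound_def
      using lp_feasible_nonneg[OF valid C k] by (intro mult_right_mono mult_left_mono) auto
    finally show ?thesis .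
  qed simp
  show ?thesis
  proof (rule coflow_completion_le[OF valid])
    fix k' f assume a: "(k', k) \<in> (prec I)\<^sup>*" and f: "f \<in> flows_of I k'"
    obtain n where "rem n f = 0" "tm n \<le> time_bound k'" using flow_time_bound[OF C f] by blast
    moreover have "f \<in> flows I" using f by (simp add: flows_of_def)
    ultimately show "flow_completion I x f \<le> time_bound k"
      using flow_completion_le_tm[of f n] mono[OF a] by simp
  next
    fix k' assume a: "(k', k) \<in> (prec I)\<^sup>*"
    show "release I k' \<le> time_bound k"
      using release_le_time_bound[OF C rtrancl_prec_coflow[OF valid a k]] mono[OF a] by simp
  qed
qed

lemma total_weighted_completion_le_lp:
  assumes C: "lp_feasible I C"
  shows "total_weighted_completion I x
    \<le> (4 * real (cores I) + 1) * real (max_path_coflows I) * (\<Sum>k\<in>coflows I. weight I k * C k)"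
proof -
  let ?c = "(4 * real (cores I) + 1) * real (max_path_coflows I)"
  have "weight I k * coflow_completion I x k \<le> ?c * (weight I k * C k)" if k: "k \<in> coflows I" for k
  proof -
    have "coflow_completion I x k \<le> time_bound k" by (rule coflow_completion_bound[OF C k])
    also have "\<dots> \<le> ?c * C k" unfolding time_bound_def
      using depth_le_max_path[OF valid k] lp_feasible_nonneg[OF valid C k]
      by (intro mult_right_mono mult_left_mono) auto
    finally have "weight I k * coflow_completion I x k \<le> weight I k * (?c * C k)"
      using valid k by (intro mult_left_mono) (auto simp: valid_instance_def)
    then show ?thesis by (simp add: mult_ac)
  qed
  then show ?thesis unfolding total_weighted_completion_def sum_distrib_left by (rule sum_mono)
qed

end

lemma list_scheduling_transmission:
  assumes v: "valid_instance I" and x: "coflow_driven_list_scheduling I x"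
  obtains C A tm rem F where "lp_optimal I C" "transmission I C A tm rem F" "x = run_schedule tm F"
proof -
  obtain C ks lI lO A tm rem F where C: "lp_optimal I C" and ks: "distinct ks" "set ks = coflows I"
    and A: "assignment_run I ks lI lO A" and run: "transmission_run I C A tm rem F"
    and xe: "x = run_schedule tm F"
    using x unfolding coflow_driven_list_scheduling_def by blast
  have "transmission I C A tm rem F"
  proof
    show "\<exists>h\<in>core_set I. k \<in> A h" if "k \<in> coflows I" for k
      using assignment_run_partition(2)[OF A ks(1)] that ks(2) by simp
    show "h = h'" if "k \<in> A h" "k \<in> A h'" for k h h'
      using assignment_run_partition(3)[OF A ks(1) that] .
  qed (fact v run)+
  with C xe that show ?thesis by blast
qed

theorem theorem3:
  fixes I :: "'k coflow_instance"
  assumes "valid_instance I"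
  shows "(\<exists>x. coflow_driven_list_scheduling I x) \<and>
    (\<forall>x. coflow_driven_list_scheduling I x \<longrightarrow>
       feasible I x \<and> indivisible I x \<and>
       total_weighted_completion I x
         \<le> (4 * real (cores I) + 1) * real (max_path_coflows I) * optimum I)"
proof (intro conjI[OF list_scheduling_exists[OF assms]] allI impI)
  fix x assume "coflow_driven_list_scheduling I x"
  with assms obtain C A tm rem F where C: "lp_optimal I C" and tr: "transmission I C A tm rem F"
    and x: "x = run_schedule tm F" by (rule list_scheduling_transmission)
  interpret transmission I C A tm rem F by (rule tr)
  have fe: "feasible I x" "indivisible I x" using feasible_x indivisible_x by (simp_all add: x)
  \<comment> \<open>The set whose infimum defines \<open>optimum\<close> is nonempty, since it
    contains the value of \<open>x\<close> itself.\<close>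
  have lp: "(\<Sum>k\<in>coflows I. weight I k * C k) \<le> optimum I"
    unfolding optimum_def
    by (rule cInf_greatest) (use fe lp_optimal_le_total[OF assms C] in auto)
  have "total_weighted_completion I x
    \<le> (4 * real (cores I) + 1) * real (max_path_coflows I) * (\<Sum>k\<in>coflows I. weight I k * C k)"
    using total_weighted_completion_le_lp C by (simp add: x lp_optimal_def)
  also have "\<dots> \<le> (4 * real (cores I) + 1) * real (max_path_coflows I) * optimum I"
    using lp by (intro mult_left_mono) auto
  finally show "feasible I x \<and> indivisible I x \<and>
       total_weighted_completion I x
         \<le> (4 * real (cores I) + 1) * real (max_path_coflows I) * optimum I"
    using fe by blast
qed

end
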